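(* Let $n\ge 2$ and $m\ge 1$ be integers, let $\alpha\in(0,1)$ be irrational, and let $b=\{m\alpha\}$. Let $\Upsilon(m;\alpha)$ denote the number of integers $q$ with $1\le q\le m$ and $\{q\alpha\}<\alpha$, and let $d=\gcd(n,m,\Upsilon(m;\alpha))$. Let $\mathcal{L}$ be any half-infinite $\alpha$-geodesic on the $n$-square-$b$ surface. Then $\mathcal{L}$ is equidistributed on the $n$-square-$b$ surface if and only if the GCD Criterion fails, i.e. if and only if it is not the case that $d>1$.
   Context: $\{z\}$ is the fractional part of $z$. For an integer $n\ge 2$ and $0<b<1$, the $n$-square-$b$ surface is built from a horizontal row of $n$ unit squares $Q_\ell=[\ell-1,\ell]\times[0,1]$, $\ell=1,\dots,n$, as follows. For each $\ell$ the top edge of $Q_\ell$ is identified with its bottom edge by vertical translation. The lower part $\{\ell\}\times[0,b)$ of the right edge of $Q_\ell$ is a $b$-size gate leading into $Q_{\ell+1}$ (indices modulo $n$; the gate on the right edge of $Q_n$ is identified by horizontal translation with $\{0\}\times[0,b)$ on the left edge of $Q_1$). The upper part $\{\ell\}\times[b,1)$ is a barrier: its left side (the part of the right edge of $Q_\ell$) is identified by horizontal translation with the part $\{\ell-1\}\times[b,1)$ of the left edge of the same square $Q_\ell$. Gates and barriers are closed at the bottom end and open at the top end. A half-infinite $\alpha$-geodesic is a trajectory on this surface moving with unit speed for all times $t\ge0$ in the fixed direction $(1,\alpha)$ (slope $\alpha$). Thus, if it leaves the left edge of $Q_\ell$ at height $x\in[0,1)$, it next arrives at height $\{x+\alpha\}$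 on the left edge of $Q_{\ell+1}$ (index modulo $n$) if $\{x+\alpha\}<b$, and on the left edge of $Q_\ell$ if $\{x+\alpha\}\ge b$. A half-infinite geodesic $\mathcal{L}(t)$ is equidistributed (uniformly distributed) on the surface if for every Jordan measurable subset $A$ of the surface, $\lim_{T\to\infty}\frac1T|\{t\in[0,T]:\mathcal{L}(t)\in A\}|=\mathrm{area}(A)/n$. *)

theory Defs
  imports "HOL-Analysis.Analysis"
begin

definition square :: "nat \<Rightarrow> (real \<times> real) set" where
  "square l = {real l - 1..real l} \<times> {0..1}"

text \<open>A pair \<open>(l, z)\<close> with \<open>1 \<le> l \<le> n\<close> and \<open>z \<in> square l\<close> is a point of the disjoint union of
  the \<open>n\<close> closed squares, so that a point of a barrier has two representatives, one for each side of
  it. The successor of the index \<open>l\<close> modulo \<open>n\<close> in \<open>{1..n}\<close> is \<open>l mod n + 1\<close>, and the left edge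
  of that square has abscissa \<open>l mod n\<close>.\<close>

type_synonym tagged_point = "nat \<times> (real \<times> real)"

inductive glue :: "nat \<Rightarrow> real \<Rightarrow> tagged_point \<Rightarrow> tagged_point \<Rightarrow> bool"
  for n :: nat and b :: real where
  horizontal: "\<lbrakk>1 \<le> l; l \<le> n; real l - 1 \<le> x; x \<le> real l\<rbrakk>
    \<Longrightarrow> glue n b (l, (x, 1)) (l, (x, 0))"
| gate: "\<lbrakk>1 \<le> l; l \<le> n; 0 \<le> y; y < b\<rbrakk>
    \<Longrightarrow> glue n b (l, (real l, y)) (l mod n + 1, (real (l mod n), y))"
| barrier: "\<lbrakk>1 \<le> l; l \<le> n; b \<le> y; y < 1\<rbrakk>
    \<Longrightarrow> glue n b (l, (real l, y)) (l, (real l - 1, y))"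

definition gluing :: "nat \<Rightarrow> real \<Rightarrow> (tagged_point \<times> tagged_point) set" where
  "gluing n b = {(p, q). equivclp (glue n b) p q}"

definition square_surface :: "nat \<Rightarrow> real \<Rightarrow> tagged_point set set" where
  "square_surface n b = (SIGMA l:{1..n}. square l) // gluing n b"

definition surface_point :: "nat \<Rightarrow> real \<Rightarrow> nat \<Rightarrow> real \<times> real \<Rightarrow> tagged_point set" where
  "surface_point n b l z = gluing n b `` {(l, z)}"

definition unit_direction :: "real \<Rightarrow> real \<times> real" where
  "unit_direction \<alpha> = (1, \<alpha>) /\<^sub>R norm (1 :: real, \<alpha>)"

text \<open>A curve on the surface is a geodesic if, around every time, it runs inside a closed square along
  a straight line with unit speed. The squares used just before and just after time \<open>t\<close> may
  differ, and the two representatives of \<open>L t\<close> are then related by the gluing. At the endpoints of gates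
  and barriers the half-open convention of \<open>glue\<close> decides how the curve continues. Values of \<open>L\<close> at
  negative times are irrelevant.\<close>

definition half_infinite_geodesic ::
    "nat \<Rightarrow> real \<Rightarrow> real \<Rightarrow> (real \<Rightarrow> tagged_point set) \<Rightarrow> bool" where
  "half_infinite_geodesic n b \<alpha> L \<longleftrightarrow>
    (\<forall>t\<ge>0. \<exists>l\<in>{1..n}. \<exists>z. \<exists>\<epsilon>>0. \<forall>s\<in>{0..\<epsilon>}.
       z + s *\<^sub>R unit_direction \<alpha> \<in> square l \<and>
       L (t + s) = surface_point n b l (z + s *\<^sub>R unit_direction \<alpha>)) \<and>
    (\<forall>t>0. \<exists>l\<in>{1..n}. \<exists>z. \<exists>\<epsilon>>0. \<epsilon> \<le> t \<and> (\<forall>s\<in>{0..\<epsilon>}.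
       z - s *\<^sub>R unit_direction \<alpha> \<in> square l \<and>
       L (t - s) = surface_point n b l (z - s *\<^sub>R unit_direction \<alpha>)))"

definition square_part ::
    "nat \<Rightarrow> real \<Rightarrow> tagged_point set set \<Rightarrow> nat \<Rightarrow> (real \<times> real) set" where
  "square_part n b A l = {z \<in> square l. surface_point n b l z \<in> A}"

definition jordan_measurable :: "(real \<times> real) set \<Rightarrow> bool" where
  "jordan_measurable S \<longleftrightarrow> bounded S \<and> negligible (frontier S)"

definition jordan_measurable_on_surface :: "nat \<Rightarrow> real \<Rightarrow> tagged_point set set \<Rightarrow> bool" where
  "jordan_measurable_on_surface n b A \<longleftrightarrow>
     A \<subseteq> square_surface n b \<and> (\<forall>l\<in>{1..n}. jordan_measurable (square_part n b A l))"

definition surface_area :: "nat \<Rightarrow> real \<Rightarrow> tagged_point set set \<Rightarrow> real" where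
  "surface_area n b A = (\<Sum>l\<in>{1..n}. measure lebesgue (square_part n b A l))"

text \<open>A Jordan measurable set may meet a trajectory in a set of times that is not Lebesgue measurable
  (its boundary may contain a segment of the trajectory), and \<^const>\<open>measure\<close> would then be
  \<open>0\<close>. Lebesgue outer measure equals Lebesgue measure whenever the set of times is measurable.\<close>

definition equidistributed ::
    "nat \<Rightarrow> real \<Rightarrow> (real \<Rightarrow> tagged_point set) \<Rightarrow> bool" where
  "equidistributed n b L \<longleftrightarrow>
    (\<forall>A. jordan_measurable_on_surface n b A \<longrightarrow>
      ((\<lambda>T. enn2real (outer_measure_of lebesgue {t \<in> {0..T}. L t \<in> A}) / T)
         \<longlongrightarrow> surface_area n b A / real n) at_top)"

definition Upsilon :: "nat \<Rightarrow> real \<Rightarrow> nat" where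
  "Upsilon m \<alpha> = card {q \<in> {1..m}. frac (real q * \<alpha>) < \<alpha>}"

end

theory Submission
  imports Defs
begin

text \<open>
  Unfold a geodesic to a line in the plane, so that after time \<open>t\<close> it is at the point
  \<open>p + t v = (X, Y)\<close>, has offset \<open>(frac X, frac Y)\<close> in its square, and has crossed a vertical edge
  whenever \<open>X\<close> passed an integer. Because \<open>b\<close> is the fractional part of \<open>m \<alpha>\<close>, the index of the square
  is, modulo \<open>n\<close> and up to a constant, the explicit function
  \<open>level (X, Y) = (\<Sum>j<m. \<lfloor>Y - \<alpha> (frac X + j)\<rfloor>) - \<lfloor>m \<alpha>\<rfloor> \<lfloor>X\<rfloor>\<close>.
  Indeed \<open>Y - \<alpha> frac X\<close> is constant along the line between two vertical edges, and at an edge the sum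
  telescopes: it gains \<open>\<lfloor>Y\<rfloor> - \<lfloor>Y - m \<alpha>\<rfloor>\<close>. After subtraction of \<open>\<lfloor>m \<alpha>\<rfloor>\<close> this is \<open>1\<close> if
  \<open>frac Y < b\<close> and \<open>0\<close> otherwise, which is the rule for gates and barriers. So the geodesic is the image
  of the line under a map \<open>develop\<close> from the plane to the surface (\<open>geodesic_is_developed_line\<close>).

  Translation by an integer vector \<open>(i, j)\<close> adds \<open>m j - \<lfloor>m \<alpha>\<rfloor> i\<close> to \<open>level\<close>, and
  \<open>\<lfloor>m \<alpha>\<rfloor> = \<Upsilon>(m; \<alpha>)\<close>.

  If \<open>d > 1\<close>, then modulo \<open>d\<close> the index depends only on the offset in the square. Near a typical offset
  the geodesic therefore visits only the squares of one residue class modulo \<open>d\<close>, and it misses a small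
  ball in any other square (\<open>not_equidistributed_if_common_divisor\<close>).

  If \<open>d = 1\<close>, note that \<open>develop\<close> has period \<open>n\<close> in both coordinates, so that the geodesic is the image of
  a line of irrational slope on the torus \<open>\<real>\<^sup>2 / n \<int>\<^sup>2\<close>. Such a line is equidistributed
  (\<open>irrational_line_equidistributed\<close>). A Jordan measurable set on the surface pulls back to a Jordan
  measurable set on the torus (\<open>negligible_frontier_develop\<close>), whose area is \<open>n\<close> times as large
  (\<open>measure_develop_vimage\<close>): over a given offset there are \<open>n\<^sup>2\<close> points of the torus, and each of the
  \<open>n\<close> squares is reached from exactly \<open>n\<close> of them, because \<open>(N, M) \<mapsto> m M - \<Upsilon> N\<close> maps onto the
  integers modulo \<open>n\<close>.

  The equidistribution of the line on the torus comes from averaging over translates. A bounded stretch of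
  the line is dense on the torus up to \<open>\<delta>\<close>, so the time spent in a set \<open>P\<close> is, up to a bounded error, at
  most the time spent in any translate of the \<open>\<delta>\<close>-neighbourhood of \<open>P\<close>. By Fubini the average of the
  latter over all translates is exactly proportional to the area of the neighbourhood. This bounds the
  limiting frequency of visits to \<open>P\<close> by the area of its closure; the complement of \<open>P\<close> gives the
  lower bound. Since only subadditivity is used, the argument works for outer measure.
\<close>

section \<open>Lines of irrational slope on a torus\<close>

text \<open>Kronecker's theorem gives for each target \<open>\<theta>\<close> some \<open>N\<close>; testing the finitely many targets \<open>j / K\<close>
makes the bound \<open>R\<close> on \<open>N\<close> independent of \<open>\<theta>\<close>.\<close>

lemma rotation_orbit_uniformly_dense:
  fixes \<alpha> :: real
  assumes "\<alpha> \<notin> \<rat>" and "\<delta> > 0"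
  obtains R :: nat where
    "\<And>\<theta>. \<exists>N\<le>R. \<exists>i::int. \<bar>real N * \<alpha> - \<theta> - of_int i\<bar> < \<delta>"
proof -
  obtain K :: nat where K: "K > 0" "1 / real K < \<delta> / 2"
    using assms(2) by (metis gr_zeroI half_gt_zero inverse_eq_divide real_arch_inverse)
  have "\<exists>k::nat. \<bar>frac (real k * \<alpha>) - real j / real K\<bar> < \<delta> / 2" if "j \<le> K" for j
    using Kronecker_approx_1_explicit[OF assms(1), of "real j / real K" "\<delta> / 2"] that K assms(2)
    by (metis divide_le_eq_1_pos divide_nonneg_nonneg half_gt_zero of_nat_0_le_iff of_nat_0_less_iff of_nat_le_iff)
  then obtain k :: "nat \<Rightarrow> nat" where k: "\<And>j. j \<le> K \<Longrightarrow> \<bar>frac (real (k j) * \<alpha>) - real j / real K\<bar> < \<delta> / 2"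
    by metis
  show thesis
  proof (rule that)
    fix \<theta> :: real
    define j where "j = nat \<lfloor>frac \<theta> * real K\<rfloor>"
    have nn: "0 \<le> frac \<theta> * real K" by simp
    have lt: "frac \<theta> * real K < real K"
      using K frac_lt_1[of \<theta>] by simp
    have j: "real j \<le> frac \<theta> * real K" "frac \<theta> * real K < real j + 1"
      unfolding j_def using nn by linarith+
    have "j \<le> K" using j lt by linarith
    have "real j / real K \<le> frac \<theta>" "frac \<theta> < real j / real K + 1 / real K"
      using j K by (simp_all add: field_simps)
    then have "\<bar>frac (real (k j) * \<alpha>) - frac \<theta>\<bar> < \<delta>"
      using k[OF \<open>j \<le> K\<close>] K by linarith
    then have "\<bar>real (k j) * \<alpha> - \<theta> - of_int (\<lfloor>real (k j) * \<alpha>\<rfloor> - \<lfloor>\<theta>\<rfloor>)\<bar> < \<delta>"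
      by (simp add: frac_def algebra_simps)
    moreover have "k j \<le> Max (k ` {..K})"
      using \<open>j \<le> K\<close> by simp
    ultimately show "\<exists>N\<le>Max (k ` {..K}). \<exists>i::int. \<bar>real N * \<alpha> - \<theta> - of_int i\<bar> < \<delta>"
      by blast
  qed
qed

lemma outer_measure_of_Un_le:
  assumes "A \<subseteq> space M" "B \<subseteq> space M"
  shows "outer_measure_of M (A \<union> B) \<le> outer_measure_of M A + outer_measure_of M B"
proof -
  obtain E F where E: "E \<in> sets M" "A \<subseteq> E" "outer_measure_of M A = emeasure M E"
    and F: "F \<in> sets M" "B \<subseteq> F" "outer_measure_of M B = emeasure M F"
    using outer_measure_of_attain assms by metis
  have "outer_measure_of M (A \<union> B) \<le> outer_measure_of M (E \<union> F)"
    using E F by (intro outer_measure_of_mono) auto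
  also have "\<dots> \<le> emeasure M E + emeasure M F"
    using E F by (simp add: emeasure_subadditive)
  finally show ?thesis using E F by simp
qed

text \<open>Reduce the shift to \<open>a' \<in> {0..<p}\<close> by periodicity; the part of \<open>{a'..<p + a'}\<close> beyond \<open>p\<close> then
folds back onto \<open>{0..<a'}\<close>.\<close>

lemma nn_integral_periodic_shift:
  fixes f :: "real \<Rightarrow> ennreal"
  assumes [measurable]: "f \<in> borel_measurable borel"
    and p: "p > 0" and per: "\<And>x. f (x + p) = f x"
  shows "(\<integral>\<^sup>+x. f (a + x) * indicator {0..<p} x \<partial>lborel) = (\<integral>\<^sup>+x. f x * indicator {0..<p} x \<partial>lborel)"
proof -
  interpret periodic_fun_simple f p
    using per by unfold_locales
  define a' where "a' = a - of_int \<lfloor>a / p\<rfloor> * p"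
  have a': "0 \<le> a'" "a' < p"
    using p floor_divide_lower[of p a] floor_divide_upper[of p a] by (auto simp: a'_def algebra_simps)
  have "f (a + x) = f (a' + x)" for x
    using minus_of_int[of "a + x" "\<lfloor>a / p\<rfloor>"] by (simp add: a'_def algebra_simps)
  then have "(\<integral>\<^sup>+x. f (a + x) * indicator {0..<p} x \<partial>lborel)
      = (\<integral>\<^sup>+x. f (a' + x) * indicator {0..<p} x \<partial>lborel)"
    by simp
  also have "\<dots> = (\<integral>\<^sup>+x. f (a' + 1 * x) * indicator {a'..<p+a'} (a' + 1 * x) \<partial>lborel)"
    by (intro nn_integral_cong) (auto simp: indicator_def)
  also have "\<dots> = (\<integral>\<^sup>+x. f x * indicator {a'..<p+a'} x \<partial>lborel)"
    using nn_integral_real_affine[of "\<lambda>x. f x * indicator {a'..<p+a'} x" 1 a'] by simp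
  also have "\<dots> = (\<integral>\<^sup>+x. f x * indicator {a'..<p} x + f x * indicator {p..<p+a'} x \<partial>lborel)"
    using a' by (intro nn_integral_cong) (auto simp: indicator_def)
  also have "\<dots> = (\<integral>\<^sup>+x. f x * indicator {a'..<p} x \<partial>lborel) + (\<integral>\<^sup>+x. f x * indicator {p..<p+a'} x \<partial>lborel)"
    by (intro nn_integral_add) auto
  also have "(\<integral>\<^sup>+x. f x * indicator {p..<p+a'} x \<partial>lborel)
      = (\<integral>\<^sup>+x. f (p + 1 * x) * indicator {p..<p+a'} (p + 1 * x) \<partial>lborel)"
    using nn_integral_real_affine[of "\<lambda>x. f x * indicator {p..<p+a'} x" 1 p] by simp
  also have "\<dots> = (\<integral>\<^sup>+x. f x * indicator {0..<a'} x \<partial>lborel)"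
    using per by (intro nn_integral_cong) (auto simp: indicator_def add.commute)
  also have "(\<integral>\<^sup>+x. f x * indicator {a'..<p} x \<partial>lborel) + \<dots>
      = (\<integral>\<^sup>+x. f x * indicator {a'..<p} x + f x * indicator {0..<a'} x \<partial>lborel)"
    by (intro nn_integral_add[symmetric]) auto
  also have "\<dots> = (\<integral>\<^sup>+x. f x * indicator {0..<p} x \<partial>lborel)"
    using a' by (intro nn_integral_cong) (auto simp: indicator_def)
  finally show ?thesis .
qed

lemma nn_integral_doubly_periodic_shift:
  fixes f :: "real \<times> real \<Rightarrow> ennreal"
  assumes f [measurable]: "f \<in> borel_measurable borel"
    and p: "p > 0" and per: "\<And>x y. f (x + p, y) = f (x, y)" "\<And>x y. f (x, y + p) = f (x, y)"
  shows "(\<integral>\<^sup>+w. f (q + w) * indicator ({0..<p} \<times> {0..<p}) w \<partial>lborel)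
    = (\<integral>\<^sup>+w. f w * indicator ({0..<p} \<times> {0..<p}) w \<partial>lborel)"
proof -
  have [measurable]: "f \<in> borel_measurable (borel \<Otimes>\<^sub>M borel)"
    by (simp add: borel_prod)
  have slices: "(\<integral>\<^sup>+w. g w * indicator ({0..<p} \<times> {0..<p}) w \<partial>lborel)
      = (\<integral>\<^sup>+x. (\<integral>\<^sup>+y. g (x, y) * indicator {0..<p} y \<partial>lborel) * indicator {0..<p} x \<partial>lborel)"
    if [measurable]: "g \<in> borel_measurable (borel \<Otimes>\<^sub>M borel)" for g :: "real \<times> real \<Rightarrow> ennreal"
  proof -
    have "(\<integral>\<^sup>+w. g w * indicator ({0..<p} \<times> {0..<p}) w \<partial>lborel)
      = (\<integral>\<^sup>+w. g w * indicator ({0..<p} \<times> {0..<p}) w \<partial>(lborel \<Otimes>\<^sub>M lborel))"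
      by (simp add: lborel_prod)
    also have "\<dots> = (\<integral>\<^sup>+x. \<integral>\<^sup>+y. g (x, y) * indicator ({0..<p} \<times> {0..<p}) (x, y) \<partial>lborel \<partial>lborel)"
      by (intro lborel.nn_integral_fst[symmetric]) measurable
    also have "\<dots> = (\<integral>\<^sup>+x. \<integral>\<^sup>+y. (g (x, y) * indicator {0..<p} y) * indicator {0..<p} x \<partial>lborel \<partial>lborel)"
      by (intro nn_integral_cong) (auto simp: indicator_def)
    also have "\<dots> = (\<integral>\<^sup>+x. (\<integral>\<^sup>+y. g (x, y) * indicator {0..<p} y \<partial>lborel) * indicator {0..<p} x \<partial>lborel)"
      by (intro nn_integral_cong nn_integral_multc) measurable
    finally show ?thesis .
  qed
  obtain q1 q2 where q: "q = (q1, q2)" by (cases q)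
  define h where "h x = (\<integral>\<^sup>+y. f (x, y) * indicator {0..<p} y \<partial>lborel)" for x
  have [measurable]: "h \<in> borel_measurable borel"
    unfolding h_def by measurable
  have shifted: "(\<lambda>w. f (q + w)) \<in> borel_measurable (borel \<Otimes>\<^sub>M borel)"
  proof -
    have "(+) q \<in> borel_measurable borel" by (intro borel_measurable_continuous_onI continuous_intros)
    then show ?thesis using f by (simp add: borel_prod measurable_compose)
  qed
  have "(\<integral>\<^sup>+w. f (q + w) * indicator ({0..<p} \<times> {0..<p}) w \<partial>lborel)
      = (\<integral>\<^sup>+x. (\<integral>\<^sup>+y. f (q1 + x, q2 + y) * indicator {0..<p} y \<partial>lborel) * indicator {0..<p} x \<partial>lborel)"
    unfolding slices[OF shifted] by (simp add: q)
  also have "\<dots> = (\<integral>\<^sup>+x. h (q1 + x) * indicator {0..<p} x \<partial>lborel)"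
    unfolding h_def by (subst nn_integral_periodic_shift[where f = "\<lambda>y. f (_, y)"]) (use p per in auto)
  also have "\<dots> = (\<integral>\<^sup>+x. h x * indicator {0..<p} x \<partial>lborel)"
    by (rule nn_integral_periodic_shift) (use p per in \<open>auto simp: h_def\<close>)
  also have "\<dots> = (\<integral>\<^sup>+w. f w * indicator ({0..<p} \<times> {0..<p}) w \<partial>lborel)"
    unfolding h_def by (subst slices) auto
  finally show ?thesis .
qed

definition doubly_periodic :: "real \<Rightarrow> (real \<times> real) set \<Rightarrow> bool" where
  "doubly_periodic p P \<longleftrightarrow>
    (\<forall>x y. ((x + p, y) \<in> P \<longleftrightarrow> (x, y) \<in> P) \<and> ((x, y + p) \<in> P \<longleftrightarrow> (x, y) \<in> P))"

lemma doubly_periodic_shift: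
  assumes "doubly_periodic p P"
  shows "z + (of_int i * p, of_int j * p) \<in> P \<longleftrightarrow> z \<in> P"
proof -
  obtain x y where z: "z = (x, y)" by (cases z)
  interpret X: periodic_fun_simple "\<lambda>x. (x, y + of_int j * p) \<in> P" p
    using assms by unfold_locales (simp add: doubly_periodic_def)
  interpret Y: periodic_fun_simple "\<lambda>y. (x, y) \<in> P" p
    using assms by unfold_locales (simp add: doubly_periodic_def)
  show ?thesis
    using X.plus_of_int[of x i] Y.plus_of_int[of y j] by (simp add: z)
qed

definition thickening :: "real \<Rightarrow> 'a::metric_space set \<Rightarrow> 'a set" where
  "thickening \<delta> P = (\<Union>x\<in>P. ball x \<delta>)"

lemma open_thickening: "open (thickening \<delta> P)"
  by (auto simp: thickening_def)

text \<open>Translations are isometries, so balls around points of \<open>P\<close> move along with \<open>P\<close>.\<close>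

lemma doubly_periodic_thickening:
  assumes "doubly_periodic p P"
  shows "doubly_periodic p (thickening \<delta> P)"
proof -
  have fwd: "z + (of_int i * p, of_int j * p) \<in> thickening \<delta> P" if z: "z \<in> thickening \<delta> P" for z and i j :: int
  proof -
    obtain x where "x \<in> P" "dist x z < \<delta>"
      using z unfolding thickening_def UN_iff mem_ball by blast
    then have "x + (of_int i * p, of_int j * p) \<in> P"
        "dist (x + (of_int i * p, of_int j * p)) (z + (of_int i * p, of_int j * p)) < \<delta>"
      using assms doubly_periodic_shift by (auto simp: dist_norm)
    then show ?thesis unfolding thickening_def UN_iff mem_ball by blast
  qed
  show ?thesis
    unfolding doubly_periodic_def
    using fwd[of _ 1 0] fwd[of _ "-1" 0] fwd[of _ 0 1] fwd[of _ 0 "-1"] by fastforce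
qed

text \<open>If the stretch \<open>t0 v\<close> of the line undoes the translation \<open>w\<close> up to a lattice vector and an error less
than \<open>\<delta>\<close>, then a visit to \<open>P\<close> at time \<open>t\<close> is followed, \<open>t0\<close> later, by a visit of the translated line
to the thickening. Only visits in the last \<open>t0\<close> units of time are lost.\<close>

lemma line_time_le_of_return:
  fixes v w q :: "real \<times> real"
  assumes per: "doubly_periodic p P"
    and t0: "0 \<le> t0" "t0 \<le> C"
    and near: "norm (t0 *\<^sub>R v + w - (of_int i * p, of_int j * p)) < \<delta>"
  shows "outer_measure_of lebesgue {t \<in> {0..T}. q + t *\<^sub>R v \<in> P}
    \<le> emeasure lborel {t \<in> {0..T}. q + t *\<^sub>R v + w \<in> thickening \<delta> P} + ennreal C"
proof -
  let ?D = "{t \<in> {0..T}. q + t *\<^sub>R v + w \<in> thickening \<delta> P}"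
  let ?A = "(+) t0 -` ?D"
  have op: "open ((\<lambda>t. q + t *\<^sub>R v + w) -` thickening \<delta> P)"
    by (intro open_vimage open_thickening continuous_intros)
  have "?D = {0..T} \<inter> ((\<lambda>t. q + t *\<^sub>R v + w) -` thickening \<delta> P)" by auto
  then have D [measurable]: "?D \<in> sets borel"
    using op by simp
  then have A: "?A \<in> sets borel"
    using measurable_sets_borel[of "(+) t0" borel ?D] by simp
  have "q + (t0 + t) *\<^sub>R v + w \<in> thickening \<delta> P" if "q + t *\<^sub>R v \<in> P" for t
  proof -
    have "q + t *\<^sub>R v + (of_int i * p, of_int j * p) \<in> P"
      using that per doubly_periodic_shift by blast
    moreover have "dist (q + t *\<^sub>R v + (of_int i * p, of_int j * p)) (q + (t0 + t) *\<^sub>R v + w) < \<delta>"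
      using near by (simp add: dist_norm norm_minus_commute algebra_simps)
    ultimately show ?thesis by (auto simp: thickening_def)
  qed
  then have "{t \<in> {0..T}. q + t *\<^sub>R v \<in> P} \<subseteq> ?A \<union> {T - t0..T}"
    using t0 by (auto simp: not_le)
  then have "outer_measure_of lebesgue {t \<in> {0..T}. q + t *\<^sub>R v \<in> P} \<le> outer_measure_of lebesgue (?A \<union> {T - t0..T})"
    by (rule outer_measure_of_mono)
  also have "\<dots> \<le> outer_measure_of lebesgue ?A + outer_measure_of lebesgue {T - t0..T}"
    by (rule outer_measure_of_Un_le) auto
  also have "outer_measure_of lebesgue ?A = emeasure lborel ?A"
    using A by simp
  also have "\<dots> = emeasure (distr lborel borel ((+) t0)) ?D"
    using D by (simp add: emeasure_distr)
  also have "\<dots> = emeasure lborel ?D"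
    by (simp add: lborel_distr_plus)
  also have "outer_measure_of lebesgue {T - t0..T} \<le> ennreal C"
    using t0 by (simp add: ennreal_leI)
  finally show ?thesis by (simp add: add_left_mono)
qed

text \<open>The key inequality. By uniform density of the rotation every translation \<open>w\<close> is undone within one
bounded time \<open>C\<close>, so \<open>line_time_le_of_return\<close> holds for all \<open>w\<close> in a fundamental square at once.
Integrating over \<open>w\<close> and exchanging the integrals replaces the time spent by a translated line by the
area of the thickening, since at each fixed time the translated point is spread uniformly over the torus.\<close>

lemma line_time_le_thickening:
  fixes v :: "real \<times> real"
  assumes p: "p > 0" and per: "doubly_periodic p P"
    and v: "fst v > 0" "snd v / fst v \<notin> \<rat>" and \<delta>: "\<delta> > 0"
  obtains C where "C \<ge> 0"
    and "\<And>q T. T \<ge> 0 \<Longrightarrow>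
      ennreal (p\<^sup>2) * outer_measure_of lebesgue {t \<in> {0..T}. q + t *\<^sub>R v \<in> P}
      \<le> ennreal T * emeasure lborel (thickening \<delta> P \<inter> {0..<p} \<times> {0..<p}) + ennreal C"
proof -
  define a where "a = snd v / fst v"
  obtain R :: nat where R: "\<And>\<theta>. \<exists>N\<le>R. \<exists>i::int. \<bar>real N * a - \<theta> - of_int i\<bar> < \<delta> / p"
    using rotation_orbit_uniformly_dense[of a "\<delta> / p"] v \<delta> p by (auto simp: a_def)
  define C where "C = (p * R + p) / fst v"
  have C0: "C \<ge> 0" using p v by (simp add: C_def)
  let ?F = "{0..<p} \<times> {0..<p}"
  let ?U = "thickening \<delta> P"
  have [measurable]: "?U \<in> sets borel" by (simp add: open_thickening)
  have mF: "emeasure lborel ?F = ennreal (p\<^sup>2)"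
    using p by (simp add: lborel_prod[symmetric] lborel.emeasure_pair_measure_Times power2_eq_square ennreal_mult)
  have F_borel [measurable]: "?F \<in> sets borel"
    unfolding borel_prod[symmetric] by measurable
  have return: "\<exists>t0 i j. 0 \<le> t0 \<and> t0 \<le> C \<and> norm (t0 *\<^sub>R v + w - (of_int i * p, of_int j * p)) < \<delta>"
    if w: "w \<in> ?F" for w
  proof -
    obtain w1 w2 where ww: "w = (w1, w2)" "0 \<le> w1" "w1 < p" using w by auto
    obtain N i where N: "N \<le> R" "\<bar>real N * a - (- (a * p - a * w1 + w2) / p) - of_int i\<bar> < \<delta> / p"
      using R by blast
    \<comment> \<open>At this time the abscissa is exactly a lattice value, and only the ordinate has to be matched.\<close>
    define t0 where "t0 = (p * N + p - w1) / fst v"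
    have "0 \<le> p * real N" using p by simp
    then have "0 \<le> t0" unfolding t0_def using ww v by (intro divide_nonneg_pos) linarith+
    moreover have "t0 \<le> C"
      unfolding t0_def C_def using N ww p v
      by (intro divide_right_mono) (auto simp: algebra_simps intro: add_increasing)
    moreover have "t0 *\<^sub>R v + w - (of_int (int N + 1) * p, of_int i * p) = (0, p * (real N * a - (- (a * p - a * w1 + w2) / p) - of_int i))"
      using v p by (cases v) (simp add: ww t0_def a_def field_simps)
    then have "norm (t0 *\<^sub>R v + w - (of_int (int N + 1) * p, of_int i * p)) = p * \<bar>real N * a - (- (a * p - a * w1 + w2) / p) - of_int i\<bar>"
      using p by (simp add: norm_Pair abs_mult)
    then have "norm (t0 *\<^sub>R v + w - (of_int (int N + 1) * p, of_int i * p)) < \<delta>"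
      using N(2) p by (simp add: field_simps)
    ultimately show ?thesis by blast
  qed
  show thesis
  proof (rule that)
    show "C * p\<^sup>2 \<ge> 0" using C0 by simp
    fix q :: "real \<times> real" and T :: real assume T: "T \<ge> 0"
    let ?E = "outer_measure_of lebesgue {t \<in> {0..T}. q + t *\<^sub>R v \<in> P}"
    let ?g = "\<lambda>w t. indicator ?U (q + t *\<^sub>R v + w) * indicator {0..T} t * indicator ?F w :: ennreal"
    have le: "?E * indicator ?F w \<le> (\<integral>\<^sup>+t. ?g w t \<partial>lborel) + ennreal C * indicator ?F w" for w
    proof (cases "w \<in> ?F")
      case True
      then obtain t0 i j where "0 \<le> t0" "t0 \<le> C" "norm (t0 *\<^sub>R v + w - (of_int i * p, of_int j * p)) < \<delta>"
        using return by blast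
      then have "?E \<le> emeasure lborel {t \<in> {0..T}. q + t *\<^sub>R v + w \<in> ?U} + ennreal C"
        using line_time_le_of_return[OF per] by blast
      also have "emeasure lborel {t \<in> {0..T}. q + t *\<^sub>R v + w \<in> ?U}
          = (\<integral>\<^sup>+t. indicator {t \<in> {0..T}. q + t *\<^sub>R v + w \<in> ?U} t \<partial>lborel)"
        by (intro nn_integral_indicator[symmetric]) measurable
      also have "\<dots> = (\<integral>\<^sup>+t. ?g w t \<partial>lborel)"
        using True by (intro nn_integral_cong) (auto simp: indicator_def)
      finally show ?thesis using True by simp
    qed auto
    have "ennreal (p\<^sup>2) * ?E = (\<integral>\<^sup>+w. ?E * indicator ?F w \<partial>lborel)"
      by (subst nn_integral_cmult_indicator) (auto simp: mF mult.commute)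
    also have "\<dots> \<le> (\<integral>\<^sup>+w. (\<integral>\<^sup>+t. ?g w t \<partial>lborel) + ennreal C * indicator ?F w \<partial>lborel)"
      by (intro nn_integral_mono le)
    also have "\<dots> = (\<integral>\<^sup>+w. (\<integral>\<^sup>+t. ?g w t \<partial>lborel) \<partial>lborel) + (\<integral>\<^sup>+w. ennreal C * indicator ?F w \<partial>lborel)"
      by (intro nn_integral_add) measurable
    also have "(\<integral>\<^sup>+w. ennreal C * indicator ?F w \<partial>lborel) = ennreal (C * p\<^sup>2)"
      using mF C0 by (simp add: nn_integral_cmult_indicator ennreal_mult)
    also have "(\<integral>\<^sup>+w. (\<integral>\<^sup>+t. ?g w t \<partial>lborel) \<partial>lborel) = (\<integral>\<^sup>+t. (\<integral>\<^sup>+w. ?g w t \<partial>lborel) \<partial>lborel)"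
      by (rule lborel_pair.Fubini'[symmetric]) measurable
    also have "\<dots> = (\<integral>\<^sup>+t. emeasure lborel (?U \<inter> ?F) * indicator {0..T} t \<partial>lborel)"
    proof (intro nn_integral_cong)
      fix t :: real
      have "(\<integral>\<^sup>+w. ?g w t \<partial>lborel)
          = (\<integral>\<^sup>+w. indicator ?U (q + t *\<^sub>R v + w) * indicator ?F w * indicator {0..T} t \<partial>lborel)"
        by (intro nn_integral_cong) (simp add: ac_simps)
      also have "\<dots> = (\<integral>\<^sup>+w. indicator ?U (q + t *\<^sub>R v + w) * indicator ?F w \<partial>lborel) * indicator {0..T} t"
        by (intro nn_integral_multc) measurable
      also have "(\<integral>\<^sup>+w. indicator ?U (q + t *\<^sub>R v + w) * indicator ?F w \<partial>lborel)
          = (\<integral>\<^sup>+w. indicator ?U w * indicator ?F w \<partial>lborel)"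
        using doubly_periodic_thickening[OF per, of \<delta>]
        by (intro nn_integral_doubly_periodic_shift p) (auto simp: indicator_def doubly_periodic_def)
      also have "\<dots> = (\<integral>\<^sup>+w. indicator (?U \<inter> ?F) w \<partial>lborel)"
        by (intro nn_integral_cong) (auto simp: indicator_def)
      also have "\<dots> = emeasure lborel (?U \<inter> ?F)"
        by (intro nn_integral_indicator) measurable
      finally show "(\<integral>\<^sup>+w. ?g w t \<partial>lborel) = emeasure lborel (?U \<inter> ?F) * indicator {0..T} t" .
    qed
    also have "\<dots> = ennreal T * emeasure lborel (?U \<inter> ?F)"
      by (subst nn_integral_cmult_indicator) (auto simp: T mult.commute)
    finally show "ennreal (p\<^sup>2) * ?E \<le> ennreal T * emeasure lborel (?U \<inter> ?F) + ennreal (C * p\<^sup>2)" .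
  qed
qed

lemma line_time_complement:
  assumes "T \<ge> 0"
  shows "ennreal T \<le> outer_measure_of lebesgue {t \<in> {0..T}. R t} + outer_measure_of lebesgue {t \<in> {0..T}. \<not> R t}"
proof -
  have "ennreal T = outer_measure_of lebesgue {0..T}" using assms by simp
  also have "{0..T} = {t \<in> {0..T}. R t} \<union> {t \<in> {0..T}. \<not> R t}" by auto
  also have "outer_measure_of lebesgue \<dots> \<le> outer_measure_of lebesgue {t \<in> {0..T}. R t} + outer_measure_of lebesgue {t \<in> {0..T}. \<not> R t}"
    by (rule outer_measure_of_Un_le) auto
  finally show ?thesis .
qed

text \<open>Gives access to outer measure as a real number, so that the final estimates avoid extended arithmetic.\<close>

lemma line_time_finite:
  obtains e where "e \<ge> 0" "outer_measure_of lebesgue {t \<in> {0..T::real}. R t} = ennreal e"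
proof -
  have "outer_measure_of lebesgue {t \<in> {0..T}. R t} \<le> outer_measure_of lebesgue {0..T}"
    by (rule outer_measure_of_mono) auto
  also have "\<dots> < top" by (simp add: emeasure_lborel_Icc_eq)
  finally show thesis
    using that by (cases "outer_measure_of lebesgue {t \<in> {0..T}. R t}") auto
qed

lemma measure_thickening_tendsto_closure:
  fixes P F :: "'a::euclidean_space set"
  assumes F: "F \<in> lmeasurable"
  shows "(\<lambda>k. measure lebesgue (thickening (1 / real (Suc k)) P \<inter> F)) \<longlonglongrightarrow> measure lebesgue (closure P \<inter> F)"
proof -
  let ?U = "\<lambda>k. thickening (1 / real (Suc k)) P"
  have m: "?U k \<inter> F \<in> lmeasurable" for k
    using fmeasurable_Int_fmeasurable[OF F, of "?U k"] by (simp add: open_thickening Int_commute)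
  have "decseq (\<lambda>k. ?U k \<inter> F)"
  proof (rule decseq_SucI)
    fix k
    have "1 / real (Suc (Suc k)) \<le> 1 / real (Suc k)" by (simp add: field_simps)
    then show "?U (Suc k) \<inter> F \<subseteq> ?U k \<inter> F"
      unfolding thickening_def using subset_ball by blast
  qed
  then have "(\<lambda>k. measure lebesgue (?U k \<inter> F)) \<longlonglongrightarrow> measure lebesgue (\<Inter>k. ?U k \<inter> F)"
    using m by (intro Lim_measure_decseq) (auto simp del: emeasure_completion intro: fmeasurableD dest: fmeasurableD2)
  moreover have "(\<Inter>k. ?U k) = closure P"
  proof (intro set_eqI iffI)
    fix x assume "x \<in> closure P"
    then have "\<exists>y\<in>P. dist y x < 1 / real (Suc k)" for k
      by (simp add: closure_approachable)
    then show "x \<in> (\<Inter>k. ?U k)"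
      by (auto simp: thickening_def)
  next
    fix x assume x: "x \<in> (\<Inter>k. ?U k)"
    show "x \<in> closure P"
      unfolding closure_approachable
    proof (intro allI impI)
      fix e :: real assume "e > 0"
      then obtain k where k: "1 / real (Suc k) < e"
        using nat_approx_posE by auto
      from x obtain y where "y \<in> P" "dist y x < 1 / real (Suc k)"
        unfolding thickening_def INT_iff UN_iff mem_ball by blast
      then show "\<exists>y\<in>P. dist y x < e" using k by force
    qed
  qed
  ultimately show ?thesis by (simp add: INT_extend_simps flip: INT_extend_simps)
qed

text \<open>Divide the key inequality by \<open>T\<close>: the additive constant disappears in the limit. Then let the
thickening shrink to the closure.\<close>

lemma line_time_limsup_le_closure:
  fixes v :: "real \<times> real"
  assumes p: "p > 0" and per: "doubly_periodic p P"
    and v: "fst v > 0" "snd v / fst v \<notin> \<rat>" and \<epsilon>: "\<epsilon> > 0"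
  shows "\<forall>\<^sub>F T in at_top. enn2real (outer_measure_of lebesgue {t \<in> {0..T}. q + t *\<^sub>R v \<in> P}) / T
      < measure lebesgue (closure P \<inter> {0..<p} \<times> {0..<p}) / p\<^sup>2 + \<epsilon>"
proof -
  let ?F = "{0..<p} \<times> {0..<p}"
  have F: "?F \<in> lmeasurable"
    by (intro bounded_set_imp_lmeasurable bounded_Times) (auto simp: lborelD borel_Times)
  have "\<forall>\<^sub>F k in sequentially. measure lebesgue (thickening (1 / real (Suc k)) P \<inter> ?F)
      < measure lebesgue (closure P \<inter> ?F) + \<epsilon> * p\<^sup>2 / 2"
    using measure_thickening_tendsto_closure[OF F] \<epsilon> p by (intro order_tendstoD(2)) auto
  then obtain k where k: "measure lebesgue (thickening (1 / real (Suc k)) P \<inter> ?F)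
      < measure lebesgue (closure P \<inter> ?F) + \<epsilon> * p\<^sup>2 / 2"
    by (meson eventually_sequentially order_refl)
  let ?U = "thickening (1 / real (Suc k)) P"
  have U: "?U \<inter> ?F \<in> lmeasurable"
    using fmeasurable_Int_fmeasurable[OF F, of "?U"] by (simp add: open_thickening Int_commute)
  obtain C where C: "C \<ge> 0" "\<And>q T. T \<ge> 0 \<Longrightarrow>
      ennreal (p\<^sup>2) * outer_measure_of lebesgue {t \<in> {0..T}. q + t *\<^sub>R v \<in> P}
      \<le> ennreal T * emeasure lborel (?U \<inter> ?F) + ennreal C"
    using line_time_le_thickening[OF p per v, of "1 / real (Suc k)"] by auto
  have "?U \<in> sets borel" "?F \<in> sets borel"
    by (auto simp: open_thickening borel_Times)
  then have "?U \<inter> ?F \<in> sets lborel" by simp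
  then have "emeasure lborel (?U \<inter> ?F) = emeasure lebesgue (?U \<inter> ?F)"
    by simp
  also have "\<dots> = ennreal (measure lebesgue (?U \<inter> ?F))"
    using U by (simp add: emeasure_eq_measure2)
  finally have eU: "emeasure lborel (?U \<inter> ?F) = ennreal (measure lebesgue (?U \<inter> ?F))" .
  have "\<forall>\<^sub>F T in at_top. T > 2 * C / (\<epsilon> * p\<^sup>2)" by (rule eventually_gt_at_top)
  moreover have "\<forall>\<^sub>F T::real in at_top. T > 0" by (rule eventually_gt_at_top)
  ultimately show ?thesis
  proof eventually_elim
    case (elim T)
    let ?E = "outer_measure_of lebesgue {t \<in> {0..T}. q + t *\<^sub>R v \<in> P}"
    let ?\<mu> = "measure lebesgue (?U \<inter> ?F)"
    obtain e where e: "?E = ennreal e" "e \<ge> 0"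
      using line_time_finite by metis
    have "ennreal (p\<^sup>2) * ennreal e \<le> ennreal T * ennreal ?\<mu> + ennreal C"
      using C(2)[of T q] elim unfolding eU e by simp
    then have "ennreal (p\<^sup>2 * e) \<le> ennreal (T * ?\<mu> + C)"
      using elim C(1) e(2) by (simp only: ennreal_mult ennreal_plus mult_nonneg_nonneg less_imp_le measure_nonneg zero_le_power2)
    then have "p\<^sup>2 * e \<le> T * ?\<mu> + C"
      using elim C(1) by (subst (asm) ennreal_le_iff) auto
    also have "\<dots> < T * (measure lebesgue (closure P \<inter> ?F) + \<epsilon> * p\<^sup>2 / 2) + T * (\<epsilon> * p\<^sup>2 / 2)"
    proof (rule add_strict_mono)
      show "T * ?\<mu> < T * (measure lebesgue (closure P \<inter> ?F) + \<epsilon> * p\<^sup>2 / 2)"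
        using k elim by simp
      show "C < T * (\<epsilon> * p\<^sup>2 / 2)"
        using elim \<epsilon> p by (simp add: field_simps)
    qed
    finally show ?case
      using elim p e by (simp add: field_simps)
  qed
qed

text \<open>Jordan measurability of the part of a periodic, hence unbounded, set inside a box.\<close>

lemma lmeasurable_Int_convex:
  fixes S K :: "'a::euclidean_space set"
  assumes "negligible (frontier S)" "convex K" "bounded K"
  shows "S \<inter> K \<in> lmeasurable"
proof (rule measurable_Jordan)
  have "negligible (frontier S \<union> frontier K)"
    using assms by (simp add: negligible_convex_frontier)
  then show "negligible (frontier (S \<inter> K))"
    using frontier_Int_subset negligible_subset by blast
  show "bounded (S \<inter> K)" using assms(3) bounded_subset by blast
qed

text \<open>The upper bound for \<open>P\<close> and for its complement suffices: the two frequencies add up to at least \<open>1\<close>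
and the two areas to exactly \<open>p\<^sup>2\<close>, so neither upper bound can fail to be attained.\<close>

theorem irrational_line_equidistributed:
  fixes v :: "real \<times> real"
  assumes p: "p > 0" and per: "doubly_periodic p P"
    and v: "fst v > 0" "snd v / fst v \<notin> \<rat>" and fr: "negligible (frontier P)"
  shows "((\<lambda>T. enn2real (outer_measure_of lebesgue {t \<in> {0..T}. q + t *\<^sub>R v \<in> P}) / T)
    \<longlongrightarrow> measure lebesgue (P \<inter> {0..<p} \<times> {0..<p}) / p\<^sup>2) at_top"
proof -
  let ?F = "{0..<p} \<times> {0..<p}"
  have F: "?F \<in> lmeasurable"
    by (intro bounded_set_imp_lmeasurable bounded_Times) (auto simp: lborelD borel_Times)
  have clos: "measure lebesgue (closure Q \<inter> ?F) = measure lebesgue (Q \<inter> ?F)"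
    if "negligible (frontier Q)" for Q :: "(real \<times> real) set"
  proof (rule measure_negligible_symdiff[symmetric])
    show "closure Q \<inter> ?F \<in> lmeasurable"
      using fmeasurable_Int_fmeasurable[OF F, of "closure Q"] by (simp add: Int_commute)
    show "negligible (closure Q \<inter> ?F - Q \<inter> ?F \<union> (Q \<inter> ?F - closure Q \<inter> ?F))"
      by (rule negligible_subset[OF that]) (use closure_subset interior_subset in \<open>force simp: frontier_def\<close>)
  qed
  have perc: "doubly_periodic p (- P)" using per by (simp add: doubly_periodic_def)
  have Pm: "P \<inter> ?F \<in> lmeasurable"
    using fr by (intro lmeasurable_Int_convex convex_Times bounded_Times) auto
  have muF: "measure lebesgue ?F = p\<^sup>2"
    using p by (simp add: measure_completion borel_Times power2_eq_square lborel_prod[symmetric] measure_def lborel.emeasure_pair_measure_Times ennreal_mult[symmetric])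
  have mu_c: "measure lebesgue (- P \<inter> ?F) = p\<^sup>2 - measure lebesgue (P \<inter> ?F)"
  proof -
    have "measure lebesgue (?F - P \<inter> ?F) = measure lebesgue ?F - measure lebesgue (P \<inter> ?F)"
      using F Pm by (intro measurable_measure_Diff) auto
    moreover have "?F - P \<inter> ?F = - P \<inter> ?F" by auto
    ultimately show ?thesis by (simp add: muF)
  qed
  let ?f = "\<lambda>P T. enn2real (outer_measure_of lebesgue {t \<in> {0..T}. q + t *\<^sub>R v \<in> P}) / T"
  let ?l = "measure lebesgue (P \<inter> ?F) / p\<^sup>2"
  show ?thesis
  proof (rule tendstoI)
    fix \<epsilon> :: real assume \<epsilon>: "\<epsilon> > 0"
    have "\<forall>\<^sub>F T in at_top. ?f P T < ?l + \<epsilon>"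
      using line_time_limsup_le_closure[OF p per v \<epsilon>] clos[OF fr] by simp
    moreover have "\<forall>\<^sub>F T in at_top. ?f (- P) T < 1 - ?l + \<epsilon>"
      using line_time_limsup_le_closure[OF p perc v \<epsilon>] clos[of "- P"] fr mu_c p
      by (simp add: diff_divide_distrib)
    moreover have "\<forall>\<^sub>F T::real in at_top. T > 0" by (rule eventually_gt_at_top)
    ultimately show "\<forall>\<^sub>F T in at_top. dist (?f P T) ?l < \<epsilon>"
    proof eventually_elim
      case (elim T)
      let ?a = "outer_measure_of lebesgue {t \<in> {0..T}. q + t *\<^sub>R v \<in> P}"
      let ?b = "outer_measure_of lebesgue {t \<in> {0..T}. q + t *\<^sub>R v \<notin> P}"
      obtain e where e: "e \<ge> 0" "?a = ennreal e"
        by (rule line_time_finite)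
      obtain e' where e': "e' \<ge> 0" "?b = ennreal e'"
        by (rule line_time_finite)
      have "ennreal T \<le> ?a + ?b" using elim line_time_complement by auto
      then have "ennreal T \<le> ennreal (e + e')"
        using e e' by simp
      then have "T \<le> e + e'"
        using e e' by (subst (asm) ennreal_le_iff) auto
      then have "1 \<le> (e + e') / T" using elim by simp
      then have "1 \<le> ?f P T + ?f (- P) T" using e e' by (simp add: add_divide_distrib)
      then show ?case using elim by (simp add: dist_real_def abs_less_iff)
    qed
  qed
qed

section \<open>Normal forms of points on the surface\<close>

text \<open>For \<open>0 < b < 1\<close> every point of the surface has exactly one representative that lies neither on the right nor on the top
edge of its square. At a corner the top edge is folded down first, so that the corner is then treated as
a point of a gate.\<close>

definition canonical :: "nat \<Rightarrow> real \<Rightarrow> tagged_point \<Rightarrow> tagged_point" where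
  "canonical n b = (\<lambda>(l, x, y).
     let y' = (if y = 1 then 0 else y) in
     if x = real l then
       if y' < b then (l mod n + 1, real (l mod n), y') else (l, real l - 1, y')
     else (l, x, y'))"

lemma canonical_eq_of_glue:
  assumes "glue n b p q" "0 < b" "b < 1"
  shows "canonical n b p = canonical n b q"
  using assms by cases (auto simp: canonical_def Let_def)

lemma canonical_eq_of_gluing:
  assumes "(p, q) \<in> gluing n b" "0 < b" "b < 1"
  shows "canonical n b p = canonical n b q"
proof -
  have "equivclp (glue n b) p q" using assms by (simp add: gluing_def)
  then show ?thesis
    by (induction rule: equivclp_induct) (use canonical_eq_of_glue[OF _ assms(2,3)] in \<open>force+\<close>)
qed

lemma equiv_gluing: "equiv UNIV (gluing n b)"
  by (auto simp: gluing_def equiv_def refl_on_def sym_def trans_def intro: equivclp_sym equivclp_trans)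

lemma surface_point_eq_iff: "surface_point n b l z = surface_point n b l' z' \<longleftrightarrow> ((l, z), (l', z')) \<in> gluing n b"
  unfolding surface_point_def using eq_equiv_class_iff[OF equiv_gluing] by simp

lemma canonical_in_gluing:
  assumes "l \<in> {1..n}" "z \<in> square l"
  shows "((l, z), canonical n b (l, z)) \<in> gluing n b"
proof -
  obtain x y where z: "z = (x, y)" "real l - 1 \<le> x" "x \<le> real l" "0 \<le> y" "y \<le> 1"
    using assms by (cases z) (auto simp: square_def)
  define y' where "y' = (if y = 1 then 0 else y)"
  have y': "0 \<le> y'" "y' < 1" using z by (auto simp: y'_def)
  have "equivclp (glue n b) (l, x, y) (l, x, y')"
    using horizontal[of l n x b] assms z by (auto simp: y'_def)
  also have "equivclp (glue n b) (l, x, y') (canonical n b (l, z))"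
    using gate[of l n y' b] barrier[of l n b y'] assms y'
    by (auto simp: canonical_def Let_def z y'_def[symmetric])
  finally show ?thesis by (simp add: gluing_def z)
qed

definition reduced_square :: "nat \<Rightarrow> (real \<times> real) set" where
  "reduced_square l = {real l - 1..<real l} \<times> {0..<1}"

lemma canonical_reduced: "z \<in> reduced_square l \<Longrightarrow> canonical n b (l, z) = (l, z)"
  by (auto simp: reduced_square_def canonical_def Let_def split: prod.splits)

text \<open>The normal form is constant on gluing classes and is the identity on points off the right and top
edges.\<close>

lemma surface_point_inject:
  assumes "z \<in> reduced_square l" "z' \<in> reduced_square l'" "0 < b" "b < 1"
    and "surface_point n b l z = surface_point n b l' z'"
  shows "l = l'" "z = z'"
  using canonical_eq_of_gluing[of "(l, z)" "(l', z')" n b] assms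
  by (auto simp: surface_point_eq_iff canonical_reduced)

lemma surface_point_canonical:
  assumes "l \<in> {1..n}" "z \<in> square l" "canonical n b (l, z) = (l', z')"
  shows "surface_point n b l z = surface_point n b l' z'"
  using canonical_in_gluing[OF assms(1,2), of b] assms(3) by (simp add: surface_point_eq_iff)

lemma reduced_square_subset: "reduced_square l \<subseteq> square l"
  by (auto simp: reduced_square_def square_def)

section \<open>Unfolding a geodesic\<close>

text \<open>The position of the unfolded line in the tower of squares, as an explicit function of the plane. Along
a line of slope \<open>\<alpha>\<close> it does not change when \<open>Y\<close> passes an integer, in accordance with the gluing of the top edge of a square to its own bottom edge.\<close>

definition level :: "real \<Rightarrow> nat \<Rightarrow> real \<times> real \<Rightarrow> int" where
  "level \<alpha> m = (\<lambda>(X, Y). (\<Sum>j<m. \<lfloor>Y - \<alpha> * (frac X + real j)\<rfloor>) - \<lfloor>real m * \<alpha>\<rfloor> * \<lfloor>X\<rfloor>)"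

text \<open>Squares are numbered from \<open>1\<close>, residues from \<open>0\<close>. The constant \<open>k\<close> is determined by the square in which the
geodesic starts.\<close>

definition sheet :: "nat \<Rightarrow> real \<Rightarrow> nat \<Rightarrow> int \<Rightarrow> real \<times> real \<Rightarrow> nat" where
  "sheet n \<alpha> m k p = nat ((k + level \<alpha> m p) mod int n) + 1"

definition position :: "nat \<Rightarrow> real \<times> real \<Rightarrow> real \<times> real" where
  "position l p = (real l - 1 + frac (fst p), frac (snd p))"

definition develop :: "nat \<Rightarrow> real \<Rightarrow> nat \<Rightarrow> int \<Rightarrow> real \<times> real \<Rightarrow> tagged_point set" where
  "develop n \<alpha> m k p =
    surface_point n (frac (real m * \<alpha>)) (sheet n \<alpha> m k p) (position (sheet n \<alpha> m k p) p)"

lemma position_reduced: "position l p \<in> reduced_square l"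
  using frac_lt_1[of "fst p"] frac_lt_1[of "snd p"] by (simp add: position_def reduced_square_def)

lemma sheet_range: "n > 0 \<Longrightarrow> sheet n \<alpha> m k p \<in> {1..n}"
  unfolding sheet_def using pos_mod_bound[of "int n" "k + level \<alpha> m p"] by (simp add: Suc_le_eq nat_less_iff)

lemma sheet_step:
  assumes "n > 0" "level \<alpha> m p' = level \<alpha> m p + 1"
  shows "sheet n \<alpha> m k p' = sheet n \<alpha> m k p mod n + 1"
proof -
  have "int (sheet n \<alpha> m k p mod n) = ((k + level \<alpha> m p) mod int n + 1) mod int n"
    using assms by (simp add: sheet_def zmod_int add.commute)
  also have "\<dots> = (k + level \<alpha> m p') mod int n"
    using assms by (simp add: mod_simps algebra_simps)
  finally have "sheet n \<alpha> m k p mod n = nat ((k + level \<alpha> m p') mod int n)" by simp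
  then show ?thesis by (simp add: sheet_def)
qed

text \<open>Along the line the quantity \<open>Y - \<alpha> frac X\<close> is constant as long as \<open>\<lfloor>X\<rfloor>\<close> is.\<close>

lemma level_along_cell:
  assumes "p' = p + s *\<^sub>R (1, \<alpha>)" "\<lfloor>fst p'\<rfloor> = \<lfloor>fst p\<rfloor>"
  shows "level \<alpha> m p' = level \<alpha> m p"
proof -
  obtain X Y where p: "p = (X, Y)" by (cases p)
  have p': "p' = (X + s, Y + s * \<alpha>)" using assms p by simp
  have "frac (X + s) = frac X + s" using assms p p' by (simp add: frac_def)
  then have "Y + s * \<alpha> - \<alpha> * (frac (X + s) + real j) = Y - \<alpha> * (frac X + real j)" for j
    by (simp add: algebra_simps)
  then have "(\<Sum>j<m. \<lfloor>Y + s * \<alpha> - \<alpha> * (frac (X + s) + real j)\<rfloor>) = (\<Sum>j<m. \<lfloor>Y - \<alpha> * (frac X + real j)\<rfloor>)"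
    by (simp only:)
  then show ?thesis using assms p p' by (simp add: level_def)
qed

text \<open>Subtracting \<open>\<beta>\<close> from \<open>y\<close> borrows a unit exactly if \<open>frac y < frac \<beta>\<close>. For \<open>\<beta> = m \<alpha>\<close> this is the
distinction between gate and barrier, and for \<open>\<beta> = \<alpha>\<close> the condition counted by \<open>Upsilon\<close>.\<close>

lemma floor_diff_frac: "\<lfloor>y\<rfloor> - \<lfloor>y - \<beta>\<rfloor> - \<lfloor>\<beta>\<rfloor> = (if frac y < frac \<beta> then 1 else 0)" for y \<beta> :: real
proof -
  have "y - \<beta> = of_int (\<lfloor>y\<rfloor> - \<lfloor>\<beta>\<rfloor>) + (frac y - frac \<beta>)" by (simp add: frac_def)
  then have "\<lfloor>y - \<beta>\<rfloor> = \<lfloor>y\<rfloor> - \<lfloor>\<beta>\<rfloor> + \<lfloor>frac y - frac \<beta>\<rfloor>" by simp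
  moreover have "\<lfloor>u - w\<rfloor> = (if u < w then -1 else 0)" if "0 \<le> u" "u < 1" "0 \<le> w" "w < 1" for u w :: real
    using that by (auto simp: floor_eq_iff)
  then have "\<lfloor>frac y - frac \<beta>\<rfloor> = (if frac y < frac \<beta> then -1 else 0)"
    by (simp add: frac_lt_1)
  ultimately show ?thesis by simp
qed

text \<open>When \<open>X\<close> reaches the next integer, \<open>frac X\<close> drops from its limit \<open>1\<close> to \<open>0\<close>, which turns the summand
with index \<open>j + 1\<close> into the former summand with index \<open>j\<close>; the sum telescopes to
\<open>\<lfloor>Y\<rfloor> - \<lfloor>Y - m \<alpha>\<rfloor>\<close>.\<close>

lemma level_across_edge:
  assumes p': "p' = p + s *\<^sub>R (1, \<alpha>)" and edge: "fst p' = of_int \<lfloor>fst p\<rfloor> + 1"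
  shows "level \<alpha> m p' = level \<alpha> m p + (if frac (snd p') < frac (real m * \<alpha>) then 1 else 0)"
proof -
  obtain X' Y where p: "p' = (X', Y)" by (cases p')
  define N where "N = \<lfloor>fst p\<rfloor>"
  have X': "X' = of_int (N + 1)" using edge p by (simp add: N_def)
  have pp: "p = (of_int N + (1 - s), Y - s * \<alpha>)"
    using p' X' p by (cases p) (simp add: algebra_simps)
  have "frac (fst p) = fst p - of_int N" by (simp add: frac_def N_def)
  then have fr: "frac (fst p) = 1 - s" by (simp add: pp)
  have "Y - s * \<alpha> - \<alpha> * (frac (fst p) + real j) = Y - \<alpha> * real (Suc j)" for j
    unfolding fr by (simp add: algebra_simps)
  moreover have "level \<alpha> m p = (\<Sum>j<m. \<lfloor>snd p - \<alpha> * (frac (fst p) + real j)\<rfloor>) - \<lfloor>real m * \<alpha>\<rfloor> * N"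
    by (simp add: level_def N_def split_beta)
  moreover have "snd p = Y - s * \<alpha>" by (simp add: pp)
  ultimately have lp: "level \<alpha> m p = (\<Sum>j<m. \<lfloor>Y - \<alpha> * real (Suc j)\<rfloor>) - \<lfloor>real m * \<alpha>\<rfloor> * N"
    by (simp only:)
  have "(\<Sum>j<m. \<lfloor>Y - \<alpha> * real j\<rfloor>) - (\<Sum>j<m. \<lfloor>Y - \<alpha> * real (Suc j)\<rfloor>) = \<lfloor>Y - \<alpha> * real 0\<rfloor> - \<lfloor>Y - \<alpha> * real m\<rfloor>"
    unfolding sum_subtractf[symmetric] by (rule sum_lessThan_telescope')
  moreover have "level \<alpha> m p' = (\<Sum>j<m. \<lfloor>Y - \<alpha> * real j\<rfloor>) - \<lfloor>real m * \<alpha>\<rfloor> * (N + 1)"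
    using p X' by (simp add: level_def)
  ultimately have "level \<alpha> m p' - level \<alpha> m p = \<lfloor>Y\<rfloor> - \<lfloor>Y - real m * \<alpha>\<rfloor> - \<lfloor>real m * \<alpha>\<rfloor>"
    using lp by (simp add: algebra_simps)
  then show ?thesis using floor_diff_frac[of Y "real m * \<alpha>"] p by simp
qed

lemma frac_of_int_add_1: "x = of_int N + f \<Longrightarrow> 0 \<le> f \<Longrightarrow> f < 1 \<Longrightarrow> frac x = f \<and> \<lfloor>x\<rfloor> = N" for x f :: real
  by (auto simp: frac_def floor_eq_iff)

text \<open>Continuity from the left. Just before \<open>p\<close> the developed line runs in the square \<open>l\<close> towards \<open>z\<close>. If
\<open>z\<close> is on the right edge, \<open>level_across_edge\<close> shows that the gluing and the formula for \<open>level\<close> agree on the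
next square; if \<open>z\<close> is on the top edge only the ordinate is reduced. A single earlier point suffices,
because it already determines the integer parts.\<close>

lemma develop_left_limit:
  assumes n: "n > 0" and \<alpha>: "\<alpha> > 0" and b: "0 < frac (real m * \<alpha>)"
    and l: "l \<in> {1..n}" and z: "z \<in> square l" and s: "s > 0"
    and zs: "z - s *\<^sub>R (1, \<alpha>) \<in> square l"
    and eq: "develop n \<alpha> m k (p - s *\<^sub>R (1, \<alpha>)) = surface_point n (frac (real m * \<alpha>)) l (z - s *\<^sub>R (1, \<alpha>))"
  shows "develop n \<alpha> m k p = surface_point n (frac (real m * \<alpha>)) l z"
proof -
  let ?b = "frac (real m * \<alpha>)"
  define p0 where "p0 = p - s *\<^sub>R (1, \<alpha>)"
  obtain x y where zz: "z = (x, y)" by (cases z)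
  obtain X Y where p: "p = (X, Y)" by (cases p)
  have pos: "s * \<alpha> > 0" using s \<alpha> by simp
  have red: "z - s *\<^sub>R (1, \<alpha>) \<in> reduced_square l"
    using z zs s pos by (auto simp: zz square_def reduced_square_def)
  note inject = surface_point_inject[OF position_reduced red b frac_lt_1 eq[unfolded develop_def]]
  have inj: "sheet n \<alpha> m k p0 = l" "position l p0 = z - s *\<^sub>R (1, \<alpha>)"
    using inject(1) inject(2)[unfolded inject(1)] unfolding p0_def by auto
  define N M where "N = \<lfloor>X - s\<rfloor>" and "M = \<lfloor>Y - s * \<alpha>\<rfloor>"
  have X: "X = of_int N + (x - real l + 1)" and Y: "Y = of_int M + y"
    using inj(2) by (auto simp: position_def p0_def p zz frac_def N_def M_def)
  have bounds: "0 < x - real l + 1" "x \<le> real l" "0 < y" "y \<le> 1"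
    using z zs s pos by (auto simp: zz square_def)
  have y': "frac Y = (if y = 1 then 0 else y)"
    using frac_of_int_add_1[OF Y] bounds Y by (cases "y = 1") auto
  have p_eq: "p = p0 + s *\<^sub>R (1, \<alpha>)" by (simp add: p0_def)
  have N: "\<lfloor>fst p0\<rfloor> = N" by (simp add: p0_def p N_def)
  have "canonical n ?b (l, z) = (sheet n \<alpha> m k p, position (sheet n \<alpha> m k p) p)"
  proof (cases "x = real l")
    case True
    then have X1: "X = of_int N + 1" using X by simp
    then have frX: "frac X = 0" by simp
    have lev: "level \<alpha> m p = level \<alpha> m p0 + (if frac Y < ?b then 1 else 0)"
      using level_across_edge[OF p_eq] N X1 p by simp
    show ?thesis
    proof (cases "frac Y < ?b")
      case True
      then have "sheet n \<alpha> m k p = l mod n + 1"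
        using sheet_step[OF n, of \<alpha> m p p0 k] lev inj by simp
      then show ?thesis using True \<open>x = real l\<close> frX y' p zz
        by (simp add: canonical_def Let_def position_def)
    next
      case False
      then have "sheet n \<alpha> m k p = l" using lev inj by (simp add: sheet_def)
      then show ?thesis using False \<open>x = real l\<close> frX y' p zz
        by (simp add: canonical_def Let_def position_def)
    qed
  next
    case False
    then have fX: "frac X = x - real l + 1" "\<lfloor>X\<rfloor> = N"
      using frac_of_int_add_1[OF X] bounds by auto
    then have "level \<alpha> m p = level \<alpha> m p0"
      using level_along_cell[OF p_eq] N p by simp
    then have "sheet n \<alpha> m k p = l" using inj by (simp add: sheet_def)
    then show ?thesis using False fX y' p zz
      by (simp add: canonical_def Let_def position_def)
  qed
  then show ?thesis
    using surface_point_canonical[OF l z] by (simp add: develop_def)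
qed

text \<open>Continuation to the right, inside one square and before it is left: nothing is glued, and all integer
parts stay the same.\<close>

lemma develop_forward:
  assumes \<alpha>: "\<alpha> > 0" and b: "0 < frac (real m * \<alpha>)"
    and s: "0 \<le> s" and z: "z \<in> reduced_square l" "z + s *\<^sub>R (1, \<alpha>) \<in> reduced_square l"
    and eq: "develop n \<alpha> m k p = surface_point n (frac (real m * \<alpha>)) l z"
  shows "develop n \<alpha> m k (p + s *\<^sub>R (1, \<alpha>)) = surface_point n (frac (real m * \<alpha>)) l (z + s *\<^sub>R (1, \<alpha>))"
proof -
  define p' where "p' = p + s *\<^sub>R (1, \<alpha>)"
  obtain x y where zz: "z = (x, y)" by (cases z)
  obtain X Y where p: "p = (X, Y)" by (cases p)
  note inject = surface_point_inject[OF position_reduced z(1) b frac_lt_1 eq[unfolded develop_def]]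
  have inj: "sheet n \<alpha> m k p = l" "position l p = z"
    using inject(1) inject(2)[unfolded inject(1)] by auto
  have X: "X + s = of_int \<lfloor>X\<rfloor> + (x + s - real l + 1)" and Y: "Y + s * \<alpha> = of_int \<lfloor>Y\<rfloor> + (y + s * \<alpha>)"
    using inj(2) by (auto simp: position_def p zz frac_def)
  have fX: "frac (X + s) = x + s - real l + 1" "\<lfloor>X + s\<rfloor> = \<lfloor>X\<rfloor>" and fY: "frac (Y + s * \<alpha>) = y + s * \<alpha>"
    using frac_of_int_add_1[OF X] frac_of_int_add_1[OF Y] z(2) by (auto simp: reduced_square_def zz)
  have "level \<alpha> m p' = level \<alpha> m p"
    using level_along_cell[OF p'_def] fX by (simp add: p p'_def)
  then have "sheet n \<alpha> m k p' = l" using inj by (simp add: sheet_def)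
  moreover have "position l p' = z + s *\<^sub>R (1, \<alpha>)"
    using fX fY by (simp add: position_def p p'_def zz)
  ultimately show ?thesis by (simp add: develop_def p'_def)
qed

text \<open>The two parts of the definition of a geodesic match \<open>develop_forward\<close> and \<open>develop_left_limit\<close>. The
geodesic and the developed line agree at time \<open>0\<close>. Let \<open>\<tau>\<close> be the infimum of the times at which they differ:
they agree before \<open>\<tau>\<close>, hence at \<open>\<tau>\<close> by continuity from the left, hence for a while after \<open>\<tau>\<close>, which is a
contradiction.\<close>

theorem geodesic_is_developed_line:
  assumes n: "n > 0" and \<alpha>: "\<alpha> > 0" and b: "0 < frac (real m * \<alpha>)"
    and geo: "half_infinite_geodesic n (frac (real m * \<alpha>)) \<alpha> L"
  obtains k p where "\<And>t. t \<ge> 0 \<Longrightarrow> L t = develop n \<alpha> m k (p + t *\<^sub>R unit_direction \<alpha>)"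
proof -
  let ?b = "frac (real m * \<alpha>)"
  define c where "c = 1 / norm (1 :: real, \<alpha>)"
  have c: "c > 0" by (simp add: c_def zero_prod_def)
  have v: "s *\<^sub>R unit_direction \<alpha> = (s * c) *\<^sub>R (1, \<alpha>)" for s
    by (simp add: unit_direction_def c_def divide_inverse)
  define runs where "runs t l z \<epsilon> \<longleftrightarrow> l \<in> {1..n} \<and> \<epsilon> > 0 \<and> (\<forall>s. 0 \<le> s \<and> s < \<epsilon> \<longrightarrow>
      z + (s * c) *\<^sub>R (1, \<alpha>) \<in> reduced_square l \<and> L (t + s) = surface_point n ?b l (z + (s * c) *\<^sub>R (1, \<alpha>)))" for t l z \<epsilon>
  have fwd: "\<exists>l z \<epsilon>. runs t l z \<epsilon>"
    if t: "t \<ge> 0" for t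
  proof -
    obtain l z \<epsilon> where *: "l \<in> {1..n}" "\<epsilon> > 0"
      "\<And>s. s \<in> {0..\<epsilon>} \<Longrightarrow> z + (s * c) *\<^sub>R (1, \<alpha>) \<in> square l \<and> L (t + s) = surface_point n ?b l (z + (s * c) *\<^sub>R (1, \<alpha>))"
      using geo t unfolding half_infinite_geodesic_def v by metis
    have "z + (s * c) *\<^sub>R (1, \<alpha>) \<in> reduced_square l" if "0 \<le> s" "s < \<epsilon>" for s
    proof -
      obtain x y where z: "z = (x, y)" by (cases z)
      have "z + (s * c) *\<^sub>R (1, \<alpha>) \<in> square l" "z + (\<epsilon> * c) *\<^sub>R (1, \<alpha>) \<in> square l"
        using *(3)[of s] *(3)[of \<epsilon>] that \<open>\<epsilon> > 0\<close> by auto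
      moreover have "s * c < \<epsilon> * c" "s * c * \<alpha> < \<epsilon> * c * \<alpha>" using that c \<alpha> by auto
      ultimately show ?thesis by (auto simp: z square_def reduced_square_def)
    qed
    then have "runs t l z \<epsilon>" using * by (auto simp: runs_def)
    then show ?thesis by blast
  qed
  have runs_0: "z \<in> reduced_square l" "L t = surface_point n ?b l z" if "runs t l z \<epsilon>" for t l z \<epsilon>
  proof -
    have "z + (0 * c) *\<^sub>R (1, \<alpha>) \<in> reduced_square l \<and> L (t + 0) = surface_point n ?b l (z + (0 * c) *\<^sub>R (1, \<alpha>))"
      using that unfolding runs_def by blast
    then show "z \<in> reduced_square l" "L t = surface_point n ?b l z"
      by (simp_all only: mult_zero_left scaleR_zero_left add_0_right)
  qed
  obtain l0 z0 \<epsilon>0 where r0: "runs 0 l0 z0 \<epsilon>0"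
    using fwd[OF order_refl] by blast
  then have l0: "l0 \<in> {1..n}" by (simp add: runs_def)
  note start = runs_0[OF r0]
  obtain x0 y0 where zz0: "z0 = (x0, y0)" by (cases z0)
  define p where "p = (x0 - (real l0 - 1), y0)"
  define k where "k = int l0 - 1 - level \<alpha> m p"
  have "sheet n \<alpha> m k p = l0"
    using l0 by (simp add: sheet_def k_def nat_diff_distrib)
  moreover have "position l0 p = z0"
    using start(1) by (simp add: position_def p_def zz0 reduced_square_def frac_eq)
  ultimately have dev0: "develop n \<alpha> m k p = L 0"
    using start(2) by (simp add: develop_def)
  let ?\<Phi> = "\<lambda>t. develop n \<alpha> m k (p + t *\<^sub>R unit_direction \<alpha>)"
  have "L t = ?\<Phi> t" if "t \<ge> 0" for t
  proof (rule ccontr)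
    assume neq: "L t \<noteq> ?\<Phi> t"
    define S where "S = {t. t \<ge> 0 \<and> L t \<noteq> ?\<Phi> t}"
    have S: "t \<in> S" "bdd_below S" using neq that by (auto simp: S_def intro: bdd_belowI[of _ 0])
    define \<tau> where "\<tau> = Inf S"
    have \<tau>0: "\<tau> \<ge> 0" unfolding \<tau>_def using S by (intro cInf_greatest) (auto simp: S_def)
    have before: "L u = ?\<Phi> u" if "0 \<le> u" "u < \<tau>" for u
      using cInf_lower[of u S] S that by (force simp: \<tau>_def S_def)
    have at: "L \<tau> = ?\<Phi> \<tau>"
    proof (cases "\<tau> = 0")
      case True
      then show ?thesis using dev0 by simp
    next
      case False
      then have "\<tau> > 0" using \<tau>0 by simp
      then obtain l z \<epsilon> where *: "l \<in> {1..n}" "\<epsilon> > 0" "\<epsilon> \<le> \<tau>"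
        "\<And>s. s \<in> {0..\<epsilon>} \<Longrightarrow> z - (s * c) *\<^sub>R (1, \<alpha>) \<in> square l \<and> L (\<tau> - s) = surface_point n ?b l (z - (s * c) *\<^sub>R (1, \<alpha>))"
        using geo unfolding half_infinite_geodesic_def v by metis
      have z: "z \<in> square l" "L \<tau> = surface_point n ?b l z"
        using *(4)[of 0] *(2) by (auto simp flip: zero_prod_def)
      have e: "z - (\<epsilon> * c) *\<^sub>R (1, \<alpha>) \<in> square l" "L (\<tau> - \<epsilon>) = surface_point n ?b l (z - (\<epsilon> * c) *\<^sub>R (1, \<alpha>))"
        using *(4)[of \<epsilon>] *(2) by auto
      have "?\<Phi> (\<tau> - \<epsilon>) = L (\<tau> - \<epsilon>)"
        using before[of "\<tau> - \<epsilon>"] *(2,3) by simp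
      moreover have "p + (\<tau> - \<epsilon>) *\<^sub>R unit_direction \<alpha> = p + \<tau> *\<^sub>R unit_direction \<alpha> - (\<epsilon> * c) *\<^sub>R (1, \<alpha>)"
        unfolding v[symmetric] by (simp add: algebra_simps)
      ultimately have "develop n \<alpha> m k (p + \<tau> *\<^sub>R unit_direction \<alpha> - (\<epsilon> * c) *\<^sub>R (1, \<alpha>)) = surface_point n ?b l (z - (\<epsilon> * c) *\<^sub>R (1, \<alpha>))"
        using e(2) by (simp only:)
      then show ?thesis
        using develop_left_limit[OF n \<alpha> b *(1) z(1) _ e(1)] z(2) *(2) c by simp
    qed
    obtain l z \<epsilon> where lz: "runs \<tau> l z \<epsilon>"
      using fwd[OF \<tau>0] by blast
    then have z: "z + (s * c) *\<^sub>R (1, \<alpha>) \<in> reduced_square l"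
        "L (\<tau> + s) = surface_point n ?b l (z + (s * c) *\<^sub>R (1, \<alpha>))" if "0 \<le> s" "s < \<epsilon>" for s
      using that by (auto simp: runs_def)
    note z0 = runs_0[OF lz]
    have after: "L (\<tau> + s) = ?\<Phi> (\<tau> + s)" if "0 \<le> s" "s < \<epsilon>" for s
    proof -
      have "develop n \<alpha> m k (p + \<tau> *\<^sub>R unit_direction \<alpha> + (s * c) *\<^sub>R (1, \<alpha>)) = surface_point n ?b l (z + (s * c) *\<^sub>R (1, \<alpha>))"
        using z[of s] z0 at that c by (intro develop_forward \<alpha> b) auto
      moreover have "p + (\<tau> + s) *\<^sub>R unit_direction \<alpha> = p + \<tau> *\<^sub>R unit_direction \<alpha> + (s * c) *\<^sub>R (1, \<alpha>)"
        unfolding v[symmetric] by (simp add: algebra_simps)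
      ultimately show ?thesis using z(2)[OF that] by (simp only:)
    qed
    have "\<tau> + \<epsilon> \<le> Inf S"
    proof (rule cInf_greatest)
      show "S \<noteq> {}" using S by auto
      fix u assume u: "u \<in> S"
      then have "\<tau> \<le> u" using S by (simp add: \<tau>_def cInf_lower)
      then show "\<tau> + \<epsilon> \<le> u"
        using after[of "u - \<tau>"] u by (force simp: S_def)
    qed
    then show False using lz by (simp add: \<tau>_def runs_def)
  qed
  then show thesis by (rule that)
qed

section \<open>Periodicity of the developing map\<close>

text \<open>The integer part of \<open>q \<alpha>\<close> increases, by \<open>1\<close>, precisely at the \<open>q\<close> with \<open>frac (q \<alpha>) < \<alpha>\<close>.\<close>

lemma Upsilon_eq_floor:
  assumes "0 < \<alpha>" "\<alpha> < 1"
  shows "int (Upsilon m \<alpha>) = \<lfloor>real m * \<alpha>\<rfloor>"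
proof (induction m)
  case 0
  then show ?case by (simp add: Upsilon_def)
next
  case (Suc m)
  define w :: nat where "w = (if frac (real (Suc m) * \<alpha>) < \<alpha> then 1 else 0)"
  have "{q \<in> {1..Suc m}. frac (real q * \<alpha>) < \<alpha>} = {q \<in> {1..m}. frac (real q * \<alpha>) < \<alpha>}
      \<union> (if frac (real (Suc m) * \<alpha>) < \<alpha> then {Suc m} else {})"
    by (auto simp: le_Suc_eq)
  then have "Upsilon (Suc m) \<alpha> = Upsilon m \<alpha> + w"
    by (simp add: Upsilon_def w_def)
  moreover have "\<lfloor>real (Suc m) * \<alpha>\<rfloor> - \<lfloor>real m * \<alpha>\<rfloor> = int w"
  proof -
    have "\<lfloor>\<alpha>\<rfloor> = 0" "frac \<alpha> = \<alpha>" using assms by (simp_all add: floor_eq_iff frac_eq)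
    moreover have "real (Suc m) * \<alpha> - \<alpha> = real m * \<alpha>" by (simp add: algebra_simps)
    ultimately show ?thesis using floor_diff_frac[of "real (Suc m) * \<alpha>" \<alpha>] by (simp add: w_def)
  qed
  ultimately show ?case
    using Suc by linarith
qed

lemma level_shift:
  "level \<alpha> m (p + (of_int i, of_int j)) = level \<alpha> m p + int m * j - \<lfloor>real m * \<alpha>\<rfloor> * i"
proof -
  obtain X Y where p: "p = (X, Y)" by (cases p)
  have "\<lfloor>Y + of_int j - \<alpha> * (frac (X + of_int i) + real r)\<rfloor> = \<lfloor>Y - \<alpha> * (frac X + real r)\<rfloor> + j" for r
  proof -
    have "Y + of_int j - \<alpha> * (frac (X + of_int i) + real r) = Y - \<alpha> * (frac X + real r) + of_int j"
      by (simp add: frac_def)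
    then show ?thesis by (simp only: floor_add_int)
  qed
  then show ?thesis by (simp add: level_def p sum.distrib algebra_simps)
qed

lemma position_shift: "position l (p + (of_int i, of_int j)) = position l p"
  by (simp add: position_def frac_def)

lemma develop_periodic:
  "develop n \<alpha> m k (p + (of_int i * real n, of_int j * real n)) = develop n \<alpha> m k p"
proof -
  have pn: "p + (of_int i * real n, of_int j * real n) = p + (of_int (i * int n), of_int (j * int n))" by simp
  have "(k + level \<alpha> m (p + (of_int (i * int n), of_int (j * int n)))) mod int n
      = ((k + level \<alpha> m p) + int n * (int m * j - \<lfloor>real m * \<alpha>\<rfloor> * i)) mod int n"
    unfolding level_shift by (simp add: algebra_simps)
  also have "\<dots> = (k + level \<alpha> m p) mod int n" by simp
  finally have "sheet n \<alpha> m k (p + (of_int (i * int n), of_int (j * int n))) = sheet n \<alpha> m k p"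
    unfolding sheet_def by (rule arg_cong)
  then show ?thesis unfolding develop_def pn position_shift by (rule arg_cong)
qed

lemma doubly_periodic_develop: "doubly_periodic (real n) (develop n \<alpha> m k -` A)"
  unfolding doubly_periodic_def
  using develop_periodic[of n \<alpha> m k _ 1 0] develop_periodic[of n \<alpha> m k _ 0 1] by (fastforce simp: vimage_def)

section \<open>Preimages of Jordan measurable sets\<close>

text \<open>A countable union of lines outside which \<open>develop\<close> is locally a translation into a fixed square. The
third kind of line carries the jumps of the summands of \<open>level\<close>; letting \<open>i\<close> range over all integers
makes the set independent of \<open>m\<close> and of \<open>\<lfloor>X\<rfloor>\<close>.\<close>

definition jump_lines :: "real \<Rightarrow> (real \<times> real) set" where
  "jump_lines \<alpha> = {p. fst p \<in> \<int> \<or> snd p \<in> \<int> \<or> (\<exists>i. snd p - \<alpha> * fst p + \<alpha> * of_int i \<in> \<int>)}"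

lemma negligible_jump_lines: "negligible (jump_lines \<alpha>)"
proof -
  let ?U = "(\<Union>i::int. {p. (1, 0) \<bullet> p = of_int i}) \<union> (\<Union>i::int. {p. (0, 1) \<bullet> p = of_int i})
      \<union> (\<Union>i::int. \<Union>j::int. {p. (- \<alpha>, 1) \<bullet> p = of_int j - \<alpha> * of_int i}) :: (real \<times> real) set"
  have "p \<in> ?U" if p: "p \<in> jump_lines \<alpha>" for p
  proof -
    consider i :: int where "fst p = of_int i" | i :: int where "snd p = of_int i"
      | i j :: int where "snd p - \<alpha> * fst p + \<alpha> * of_int i = of_int j"
      using p by (auto simp: jump_lines_def elim!: Ints_cases)
    then show ?thesis
    proof cases
      case (3 i j)
      then have "(- \<alpha>, 1) \<bullet> p = of_int j - \<alpha> * of_int i"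
        by (simp add: inner_prod_def)
      then show ?thesis by blast
    qed (auto simp: inner_prod_def)
  qed
  moreover have "negligible ?U"
    by (intro negligible_Un negligible_countable_Union countable_image) (auto intro!: negligible_hyperplane negligible_countable_Union simp: zero_prod_def)
  ultimately show ?thesis by (meson negligible_subset subsetI)
qed

lemma level_locally_constant:
  assumes "p \<notin> jump_lines \<alpha>"
  shows "\<forall>\<^sub>F p' in nhds p. \<lfloor>fst p'\<rfloor> = \<lfloor>fst p\<rfloor> \<and> \<lfloor>snd p'\<rfloor> = \<lfloor>snd p\<rfloor> \<and> level \<alpha> m p' = level \<alpha> m p"
proof -
  define N where "N = \<lfloor>fst p\<rfloor>"
  have 1: "\<forall>\<^sub>F p' in nhds p. \<lfloor>fst p'\<rfloor> = \<lfloor>fst p\<rfloor>"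
    using assms by (intro eventually_floor_eq tendsto_intros filterlim_ident) (auto simp: jump_lines_def)
  have 2: "\<forall>\<^sub>F p' in nhds p. \<lfloor>snd p'\<rfloor> = \<lfloor>snd p\<rfloor>"
    using assms by (intro eventually_floor_eq tendsto_intros filterlim_ident) (auto simp: jump_lines_def)
  have 3: "\<forall>\<^sub>F p' in nhds p. \<forall>j\<in>{..<m}.
      \<lfloor>snd p' - \<alpha> * (fst p' - of_int N + real j)\<rfloor> = \<lfloor>snd p - \<alpha> * (fst p - of_int N + real j)\<rfloor>"
  proof (intro eventually_ball_finite ballI)
    fix j
    have "snd p - \<alpha> * (fst p - of_int N + real j) = snd p - \<alpha> * fst p + \<alpha> * of_int (N - int j)"
      by (simp add: algebra_simps)
    then have "snd p - \<alpha> * (fst p - of_int N + real j) \<notin> \<int>"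
      using assms unfolding jump_lines_def by (metis (mono_tags, lifting) mem_Collect_eq)
    then show "\<forall>\<^sub>F p' in nhds p. \<lfloor>snd p' - \<alpha> * (fst p' - of_int N + real j)\<rfloor> = \<lfloor>snd p - \<alpha> * (fst p - of_int N + real j)\<rfloor>"
      by (intro eventually_floor_eq tendsto_intros filterlim_ident)
  qed simp
  from 1 2 3 show ?thesis
    by eventually_elim (simp add: level_def split_beta frac_def N_def)
qed

lemma frontier_cong_nhds:
  fixes p :: "'a::metric_space"
  assumes "\<forall>\<^sub>F x in nhds p. x \<in> S \<longleftrightarrow> x \<in> T" "p \<in> frontier S"
  shows "p \<in> frontier T"
  unfolding frontier_straddle
proof (intro allI impI)
  fix e :: real assume "e > 0"
  obtain d where d: "d > 0" "\<And>x. dist x p < d \<Longrightarrow> x \<in> S \<longleftrightarrow> x \<in> T"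
    using assms(1) by (auto simp: eventually_nhds_metric)
  have "min d e > 0" using d \<open>e > 0\<close> by simp
  then obtain x y where "x \<in> S" "dist p x < min d e" "y \<notin> S" "dist p y < min d e"
    using assms(2) unfolding frontier_straddle by metis
  then show "(\<exists>x\<in>T. dist p x < e) \<and> (\<exists>x. x \<notin> T \<and> dist p x < e)"
    using d(2) by (metis dist_commute min_less_iff_conj)
qed

text \<open>Off the jump lines the preimage of \<open>A\<close> coincides near each point with a translate, by an integer vector,
of the part of \<open>A\<close> in one square. So its frontier is covered by the jump lines and by countably many
translates of negligible frontiers.\<close>

lemma negligible_frontier_develop:
  assumes n: "n > 0" and A: "jordan_measurable_on_surface n (frac (real m * \<alpha>)) A"
  shows "negligible (frontier (develop n \<alpha> m k -` A))"
proof -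
  let ?P = "square_part n (frac (real m * \<alpha>)) A"
  let ?a = "\<lambda>l N M. (of_int N - real l + 1, of_int M) :: real \<times> real"
  have "p \<in> jump_lines \<alpha> \<union> (\<Union>l\<in>{1..n}. \<Union>N::int. \<Union>M::int. (+) (?a l N M) ` frontier (?P l))"
    if fr: "p \<in> frontier (develop n \<alpha> m k -` A)" for p
  proof (cases "p \<in> jump_lines \<alpha>")
    case False
    define l where "l = sheet n \<alpha> m k p"
    let ?b = "?a l \<lfloor>fst p\<rfloor> \<lfloor>snd p\<rfloor>"
    have l: "l \<in> {1..n}" unfolding l_def using n by (rule sheet_range)
    have "\<forall>\<^sub>F p' in nhds p. p' \<in> develop n \<alpha> m k -` A \<longleftrightarrow> p' \<in> (+) ?b ` ?P l"
      using level_locally_constant[OF False, of m]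
    proof eventually_elim
      case (elim p')
      then have sh: "sheet n \<alpha> m k p' = l" by (simp add: l_def sheet_def)
      have pos: "position l p' = p' - ?b"
        using elim by (cases p') (simp add: position_def frac_def)
      have "p' \<in> develop n \<alpha> m k -` A \<longleftrightarrow> position l p' \<in> ?P l"
        using position_reduced[of l p'] reduced_square_subset[of l]
        by (auto simp: develop_def sh square_part_def)
      also have "\<dots> \<longleftrightarrow> p' \<in> (+) ?b ` ?P l"
        unfolding pos by (metis (no_types, lifting) add_diff_cancel_left' add_diff_eq image_iff diff_add_cancel add.commute)
      finally show ?case .
    qed
    then have "p \<in> frontier ((+) ?b ` ?P l)" using fr by (rule frontier_cong_nhds)
    then have "p \<in> (+) ?b ` frontier (?P l)" by (simp only: frontier_translation)
    then show ?thesis using l by blast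
  qed simp
  moreover have "negligible (jump_lines \<alpha> \<union> (\<Union>l\<in>{1..n}. \<Union>N::int. \<Union>M::int. (+) (?a l N M) ` frontier (?P l)))"
  proof -
    have "negligible ((+) (?a l N M) ` frontier (?P l))" if "l \<in> {1..n}" for l N M
      using A that by (intro negligible_translation) (auto simp: jordan_measurable_on_surface_def jordan_measurable_def)
    then show ?thesis
      by (intro negligible_Un negligible_jump_lines negligible_countable_Union countable_image) (auto intro!: negligible_countable_Union)
  qed
  ultimately show ?thesis by (meson negligible_subset subsetI)
qed

text \<open>Shifting by \<open>1\<close> exchanges one summand for an equal one, so the sum has period \<open>1\<close> in \<open>a\<close>.\<close>

lemma sum_over_period_shift:
  fixes f :: "int \<Rightarrow> real"
  assumes per: "\<And>a. f (a + int n) = f a"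
  shows "(\<Sum>j<n. f (int j + a)) = (\<Sum>j<n. f (int j))"
proof -
  interpret periodic_fun_simple "\<lambda>a. \<Sum>j<n. f (int j + a)" 1
  proof
    fix a
    have "(\<Sum>j<n. f (int (Suc j) + a)) + f a = (\<Sum>j<n. f (int j + a)) + f (int n + a)"
      using sum.lessThan_Suc_shift[of "\<lambda>j. f (int j + a)" n] sum.lessThan_Suc[of "\<lambda>j. f (int j + a)" n]
      by simp
    moreover have "f (int n + a) = f a" using per[of a] by (simp add: add.commute)
    ultimately show "(\<Sum>j<n. f (int j + (a + 1))) = (\<Sum>j<n. f (int j + a))"
      by (simp add: algebra_simps)
  qed
  show ?thesis using plus_of_int[of 0 a] by simp
qed

text \<open>The counting behind the case \<open>d = 1\<close>: each residue modulo \<open>n\<close> is taken \<open>n\<close> times by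
\<open>c + m M - u N\<close> on the \<open>n \<times> n\<close> square. As a function of \<open>c\<close> the double sum has the periods \<open>n\<close>,
\<open>m\<close> and \<open>u\<close>, hence by Bezout the period \<open>1\<close>. It is therefore constant, and its average over
\<open>c < n\<close> can be computed directly.\<close>

lemma sum_periodic_along_coprime_steps:
  fixes f :: "int \<Rightarrow> real" and m u :: int
  assumes per: "\<And>a. f (a + int n) = f a" and cop: "gcd (int n) (gcd m u) = 1"
  shows "(\<Sum>N<n. \<Sum>M<n. f (c + m * int M - u * int N)) = real n * (\<Sum>a<n. f (int a))"
proof -
  interpret f: periodic_fun_simple f "int n" using per by unfold_locales
  define S where "S c = (\<Sum>N<n. \<Sum>M<n. f (c + m * int M - u * int N))" for c
  have shift: "(\<Sum>j<n. g (Suc j)) = (\<Sum>j<n. g j)" if "g n = g 0" for g :: "nat \<Rightarrow> real"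
    using sum.lessThan_Suc_shift[of g n] sum.lessThan_Suc[of g n] that by simp
  interpret Sn: periodic_fun_simple S "int n"
  proof
    fix c
    have "f (c + int n + m * int M - u * int N) = f (c + m * int M - u * int N)" for M N
      using per[of "c + m * int M - u * int N"] by (simp add: algebra_simps)
    then show "S (c + int n) = S c" by (simp add: S_def)
  qed
  interpret Sm: periodic_fun_simple S m
  proof
    fix c
    have "(\<Sum>M<n. f (c + m + m * int M - u * int N)) = (\<Sum>M<n. f (c + m * int M - u * int N))" for N
    proof -
      have "f (c + m * int n - u * int N) = f (c + m * int 0 - u * int N)"
        using f.plus_of_int[of "c - u * int N" m] by (simp add: algebra_simps)
      from shift[of "\<lambda>M. f (c + m * int M - u * int N)", OF this] show ?thesis
        by (simp add: algebra_simps)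
    qed
    then show "S (c + m) = S c" by (simp add: S_def)
  qed
  interpret Su: periodic_fun_simple S "- u"
  proof
    fix c
    have "f (c + m * int M - u * int n) = f (c + m * int M - u * int 0)" for M
      using f.minus_of_int[of "c + m * int M" u] by (simp add: algebra_simps)
    then have "(\<Sum>M<n. f (c + m * int M - u * int n)) = (\<Sum>M<n. f (c + m * int M - u * int 0))"
      by simp
    from shift[of "\<lambda>N. \<Sum>M<n. f (c + m * int M - u * int N)", OF this]
    show "S (c + - u) = S c" by (simp add: S_def algebra_simps)
  qed
  obtain x y where xy: "x * m + y * u = gcd m u" using bezout_int by blast
  obtain z w where "z * int n + w * gcd m u = 1" using bezout_int[of "int n" "gcd m u"] cop by auto
  then have bez: "1 = z * int n + (w * x) * m + (- (w * y)) * (- u)"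
    by (simp add: xy[symmetric] algebra_simps)
  have "S (c + 1) = S c" for c
    unfolding bez using Su.plus_of_int[of "c + z * int n + (w * x) * m" "- (w * y)"]
      Sm.plus_of_int[of "c + z * int n" "w * x"] Sn.plus_of_int[of c z]
    by (simp add: add.assoc)
  then interpret S1: periodic_fun_simple S 1 by unfold_locales
  have const: "S c = S 0" for c using S1.plus_of_int[of 0 c] by simp
  have "real n * S c = (\<Sum>a<n. S (int a))"
    unfolding const[of c] const[of "int _"] by simp
  also have "\<dots> = (\<Sum>N<n. \<Sum>M<n. \<Sum>a<n. f (int a + (m * int M - u * int N)))"
    unfolding S_def by (subst sum.swap, subst (2) sum.swap) (simp add: algebra_simps)
  also have "\<dots> = real n * (real n * (\<Sum>a<n. f (int a)))"
    by (simp add: sum_over_period_shift[of f n, OF per])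
  finally show ?thesis
    by (cases "n = 0") (simp_all add: S_def)
qed

lemma measure_square_part_reduced:
  assumes "jordan_measurable_on_surface n b A" "l \<in> {1..n}"
  shows "square_part n b A l \<inter> reduced_square l \<in> lmeasurable"
    and "measure lebesgue (square_part n b A l \<inter> reduced_square l) = measure lebesgue (square_part n b A l)"
proof -
  let ?S = "square_part n b A l"
  have S: "bounded ?S" "negligible (frontier ?S)"
    using assms by (auto simp: jordan_measurable_on_surface_def jordan_measurable_def)
  have R: "convex (reduced_square l)" "bounded (reduced_square l)"
    unfolding reduced_square_def by (auto intro: convex_Times bounded_Times)
  show "?S \<inter> reduced_square l \<in> lmeasurable"
    using S R by (intro lmeasurable_Int_convex)
  have "square l - reduced_square l \<subseteq> {z. (1, 0) \<bullet> z = real l} \<union> {z. (0, 1) \<bullet> z = 1}"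
    by (auto simp: square_def reduced_square_def inner_prod_def)
  moreover have "negligible ({z. (1, 0) \<bullet> z = real l} \<union> {z. (0, 1) \<bullet> z = (1::real)} :: (real \<times> real) set)"
    by (intro negligible_Un negligible_hyperplane) (auto simp: zero_prod_def)
  ultimately have "negligible (square l - reduced_square l)" by (rule negligible_subset[rotated])
  moreover have "?S - ?S \<inter> reduced_square l \<union> (?S \<inter> reduced_square l - ?S) \<subseteq> square l - reduced_square l"
    by (auto simp: square_part_def)
  ultimately show "measure lebesgue (?S \<inter> reduced_square l) = measure lebesgue ?S"
    using S by (intro measure_negligible_symdiff measurable_Jordan) (auto intro: negligible_subset)
qed

text \<open>Cut the fundamental square of side \<open>n\<close> into unit cells and move all cells to one unit square \<open>Q\<close>. At each
point of \<open>Q\<close> the number of cells whose point is in the preimage is, by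
\<open>sum_periodic_along_coprime_steps\<close>, \<open>n\<close> times the number of squares in which that offset belongs to
\<open>A\<close>. Integration over \<open>Q\<close> gives the areas.\<close>

lemma measure_develop_vimage:
  assumes n: "n > 0" and A: "jordan_measurable_on_surface n (frac (real m * \<alpha>)) A"
    and cop: "gcd (int n) (gcd (int m) \<lfloor>real m * \<alpha>\<rfloor>) = 1"
  shows "measure lebesgue (develop n \<alpha> m k -` A \<inter> {0..<real n} \<times> {0..<real n})
    = real n * surface_area n (frac (real m * \<alpha>)) A"
proof -
  let ?b = "frac (real m * \<alpha>)"
  let ?B = "develop n \<alpha> m k -` A"
  let ?u = "\<lfloor>real m * \<alpha>\<rfloor>"
  define Q where "Q = {0..<1::real} \<times> {0..<1::real}"
  define C where "C = (\<lambda>(N, M). {real N..<real N + 1} \<times> {real M..<real M + 1})"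
  define D where "D = (\<lambda>(N, M). {q \<in> Q. q + (real N, real M) \<in> ?B})"
  define E where "E l = {q \<in> Q. q + (real l - 1, 0) \<in> square_part n ?b A l}" for l
  let ?I = "{..<n} \<times> {..<n}"
  have BC: "?B \<inter> C i \<in> lmeasurable" for i
    unfolding C_def split_beta using negligible_frontier_develop[OF n A]
    by (intro lmeasurable_Int_convex) (auto intro: convex_Times bounded_Times)
  have BC_D: "?B \<inter> C (N, M) = (+) (real N, real M) ` D (N, M)" for N M
  proof (intro set_eqI iffI)
    fix p assume "p \<in> ?B \<inter> C (N, M)"
    then have "p - (real N, real M) \<in> D (N, M)" "p = (real N, real M) + (p - (real N, real M))"
      by (auto simp: C_def D_def Q_def)
    then show "p \<in> (+) (real N, real M) ` D (N, M)" by blast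
  qed (auto simp: C_def D_def Q_def add.commute)
  have D_BC: "D (N, M) = (+) (- (real N, real M)) ` (?B \<inter> C (N, M))" for N M
    unfolding BC_D image_image minus_add_cancel by simp
  have D: "D i \<in> lmeasurable" for i
    using measurable_translation[OF BC] D_BC by (cases i) metis
  have E_part: "square_part n ?b A l \<inter> reduced_square l = (+) (real l - 1, 0) ` E l" for l
  proof (intro set_eqI iffI)
    fix p assume "p \<in> square_part n ?b A l \<inter> reduced_square l"
    then have "p - (real l - 1, 0) \<in> E l" "p = (real l - 1, 0) + (p - (real l - 1, 0))"
      by (auto simp: E_def Q_def reduced_square_def)
    then show "p \<in> (+) (real l - 1, 0) ` E l" by blast
  qed (auto simp: E_def Q_def reduced_square_def add.commute)
  have E_tr: "E l = (+) (- (real l - 1, 0)) ` (square_part n ?b A l \<inter> reduced_square l)" for l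
    unfolding E_part image_image minus_add_cancel by simp
  have E: "E l \<in> lmeasurable" "measure lebesgue (E l) = measure lebesgue (square_part n ?b A l)" if "l \<in> {1..n}" for l
    using measure_square_part_reduced[OF A that] E_tr[of l] measurable_translation measure_translation by metis+
  have ind_int: "integrable lebesgue (indicat_real S)" "integral\<^sup>L lebesgue (indicat_real S) = measure lebesgue S"
    if "S \<in> lmeasurable" for S :: "(real \<times> real) set"
    using that by (auto simp: fmeasurable_def)
  \<comment> \<open>Here \<open>D (N, M)\<close> is the part of the preimage in the cell with corner \<open>(N, M)\<close>, and \<open>E l\<close> the part of \<open>A\<close> in the square \<open>l\<close>, both moved to \<open>Q\<close>.\<close>
  have count: "(\<Sum>i\<in>?I. indicat_real (D i) q) = (\<Sum>l\<in>{1..n}. real n * indicat_real (E l) q)" for q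
  proof (cases "q \<in> Q")
    case True
    obtain s y where q: "q = (s, y)" "0 \<le> s" "s < 1" "0 \<le> y" "y < 1" using True by (auto simp: Q_def)
    define f where "f a = indicat_real A (surface_point n ?b (nat (a mod int n) + 1) (real (nat (a mod int n)) + s, y))" for a
    define c where "c = k + level \<alpha> m q"
    have "indicat_real (D (N, M)) q = f (c + int m * int M - ?u * int N)" for N M
    proof -
      have "k + level \<alpha> m (q + (real N, real M)) = c + int m * int M - ?u * int N"
        using level_shift[of \<alpha> m q "int N" "int M"] by (simp add: c_def)
      then have "sheet n \<alpha> m k (q + (real N, real M)) = nat ((c + int m * int M - ?u * int N) mod int n) + 1"
        by (simp only: sheet_def)
      moreover have "position l (q + (real N, real M)) = position l q" for l
        using position_shift[of l q "int N" "int M"] by simp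
      moreover have "position l q = (real l - 1 + s, y)" for l
        using q by (simp add: position_def frac_eq)
      ultimately show ?thesis
        using True by (simp add: D_def f_def indicator_def develop_def)
    qed
    then have "(\<Sum>i\<in>?I. indicat_real (D i) q) = (\<Sum>N<n. \<Sum>M<n. f (c + int m * int M - ?u * int N))"
      by (simp add: sum.cartesian_product')
    also have "\<dots> = real n * (\<Sum>a<n. f (int a))"
      using cop by (intro sum_periodic_along_coprime_steps) (auto simp: f_def)
    also have "(\<Sum>a<n. f (int a)) = (\<Sum>a<n. indicat_real (E (Suc a)) q)"
    proof (intro sum.cong refl)
      fix a assume "a \<in> {..<n}"
      then have "f (int a) = indicat_real A (surface_point n ?b (Suc a) (real a + s, y))"
        by (simp add: f_def)
      moreover have "(real a + s, y) \<in> square (Suc a)" using q by (simp add: square_def)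
      ultimately show "f (int a) = indicat_real (E (Suc a)) q"
        using True by (simp add: E_def square_part_def indicator_def q add.commute)
    qed
    also have "\<dots> = (\<Sum>l\<in>{1..n}. indicat_real (E l) q)"
      by (simp add: sum.atLeast1_atMost_eq)
    finally show ?thesis by (simp add: sum_distrib_left)
  next
    case False
    then have "q \<notin> D i" "q \<notin> E l" for i l
      by (auto simp: D_def E_def split: prod.splits)
    then show ?thesis by simp
  qed
  have "?B \<inter> {0..<real n} \<times> {0..<real n} = (\<Union>i\<in>?I. ?B \<inter> C i)"
  proof (intro set_eqI iffI)
    fix p assume "p \<in> ?B \<inter> {0..<real n} \<times> {0..<real n}"
    then obtain X Y where p: "p = (X, Y)" "p \<in> ?B" "0 \<le> X" "X < real n" "0 \<le> Y" "Y < real n" by auto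
    then have "nat \<lfloor>X\<rfloor> < n" "nat \<lfloor>Y\<rfloor> < n" by (simp_all add: nat_less_iff floor_less_iff)
    moreover have "p \<in> C (nat \<lfloor>X\<rfloor>, nat \<lfloor>Y\<rfloor>)" using p by (simp add: C_def)
    ultimately show "p \<in> (\<Union>i\<in>?I. ?B \<inter> C i)" using p(2) by blast
  next
    fix p assume "p \<in> (\<Union>i\<in>?I. ?B \<inter> C i)"
    then obtain N M where "N < n" "M < n" "p \<in> ?B" "p \<in> C (N, M)" by auto
    moreover from this have "real N + 1 \<le> real n" "real M + 1 \<le> real n" by linarith+
    ultimately show "p \<in> ?B \<inter> {0..<real n} \<times> {0..<real n}" by (auto simp: C_def)
  qed
  then have "measure lebesgue (?B \<inter> {0..<real n} \<times> {0..<real n}) = measure lebesgue (\<Union>i\<in>?I. ?B \<inter> C i)"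
    by (rule arg_cong)
  also have "\<dots> = (\<Sum>i\<in>?I. measure lebesgue (?B \<inter> C i))"
  proof (rule measure_finite_Union)
    show "disjoint_family_on (\<lambda>i. ?B \<inter> C i) ?I"
      unfolding disjoint_family_on_def
    proof (intro ballI impI)
      fix i j :: "nat \<times> nat" assume "i \<noteq> j"
      moreover have "i = j" if "p \<in> C i" "p \<in> C j" for p
      proof -
        have "x = y" if "real x \<le> t" "t < real x + 1" "real y \<le> t" "t < real y + 1" for x y and t :: real
          using that by linarith
        then show ?thesis using that by (cases i, cases j) (auto simp: C_def)
      qed
      ultimately show "?B \<inter> C i \<inter> (?B \<inter> C j) = {}" by blast
    qed
  qed (use BC[THEN fmeasurableD] BC[THEN fmeasurableD2] in \<open>auto simp del: emeasure_completion\<close>)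
  also have "\<dots> = (\<Sum>i\<in>?I. measure lebesgue (D i))"
    by (intro sum.cong refl) (auto simp: BC_D measure_translation)
  also have "\<dots> = (\<Sum>i\<in>?I. integral\<^sup>L lebesgue (indicat_real (D i)))"
    using D by (simp add: ind_int)
  also have "\<dots> = integral\<^sup>L lebesgue (\<lambda>q. \<Sum>i\<in>?I. indicat_real (D i) q)"
    using D by (intro Bochner_Integration.integral_sum[symmetric] ind_int)
  also have "\<dots> = integral\<^sup>L lebesgue (\<lambda>q. \<Sum>l\<in>{1..n}. real n * indicat_real (E l) q)"
    by (simp only: count)
  also have "\<dots> = (\<Sum>l\<in>{1..n}. integral\<^sup>L lebesgue (\<lambda>q. real n * indicat_real (E l) q))"
    using E by (intro Bochner_Integration.integral_sum integrable_mult_right ind_int)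
  also have "\<dots> = (\<Sum>l\<in>{1..n}. real n * measure lebesgue (square_part n ?b A l))"
    using E by (intro sum.cong refl) (simp add: ind_int)
  finally show ?thesis by (simp add: surface_area_def sum_distrib_left)
qed

section \<open>The two cases of the criterion\<close>

text \<open>A point in the interior of a square is glued to no other point.\<close>

lemma canonical_interior_eq:
  assumes "canonical n b (l', z') = (l, z)" "real l - 1 < fst z" "fst z < real l" "0 < snd z"
    and "z' \<in> square l'"
  shows "l' = l" "z' = z"
proof -
  have "l' = l \<and> z' = z"
    using assms by (cases z'; cases z) (auto simp: canonical_def Let_def square_def split: if_splits)
  then show "l' = l" "z' = z" by auto
qed

text \<open>A ball inside a square is a Jordan measurable set of positive area which the curve visits with frequency
\<open>0\<close>.\<close>

lemma not_equidistributed_if_avoids_ball: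
  assumes b: "0 < b" "b < 1" and n: "n > 0" and l: "l \<in> {1..n}" and r: "r > 0"
    and ball: "ball z r \<subseteq> {real l - 1<..<real l} \<times> {0<..<1}"
    and avoid: "\<And>t. t \<ge> 0 \<Longrightarrow> L t \<notin> surface_point n b l ` ball z r"
  shows "\<not> equidistributed n b L"
proof
  assume eq: "equidistributed n b L"
  define A where "A = surface_point n b l ` ball z r"
  have interior: "real l - 1 < fst w" "fst w < real l" "0 < snd w" "snd w < 1" if "w \<in> ball z r" for w
    using ball that by (auto dest!: subsetD)
  have sq: "w \<in> square l" if "w \<in> ball z r" for w
    using interior[OF that] by (cases w) (simp add: square_def)
  have part: "square_part n b A l' = (if l' = l then ball z r else {})" if "l' \<in> {1..n}" for l'
  proof -
    have only: "l' = l \<and> z' \<in> ball z r" if z': "z' \<in> square_part n b A l'" for z'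
    proof -
      obtain w where w: "w \<in> ball z r" "surface_point n b l' z' = surface_point n b l w"
        using z' by (auto simp: square_part_def A_def)
      then have "canonical n b (l', z') = canonical n b (l, w)"
        using canonical_eq_of_gluing[OF _ b] by (simp add: surface_point_eq_iff)
      moreover have "w \<in> reduced_square l"
        using interior[OF w(1)] by (cases w) (simp add: reduced_square_def)
      ultimately have "canonical n b (l', z') = (l, w)" by (simp add: canonical_reduced)
      moreover have "z' \<in> square l'" using z' by (simp add: square_part_def)
      ultimately show ?thesis using canonical_interior_eq interior[OF w(1)] w(1) by metis
    qed
    have "ball z r \<subseteq> square_part n b A l"
      using sq unfolding square_part_def A_def by blast
    moreover have "square_part n b A l' \<subseteq> ball z r" using only by blast
    moreover have "square_part n b A l' = {}" if "l' \<noteq> l" using only that by blast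
    ultimately show ?thesis by (cases "l' = l") (simp_all only: if_True if_False simp_thms subset_antisym)
  qed
  have "jordan_measurable_on_surface n b A"
    unfolding jordan_measurable_on_surface_def
  proof (intro conjI ballI)
    show "A \<subseteq> square_surface n b"
      unfolding A_def square_surface_def surface_point_def
      using l sq by (intro image_subsetI quotientI) simp
    show "jordan_measurable (square_part n b A l')" if "l' \<in> {1..n}" for l'
      using part[OF that] by (auto simp: jordan_measurable_def negligible_convex_frontier)
  qed
  then have lim: "((\<lambda>T. enn2real (outer_measure_of lebesgue {t \<in> {0..T}. L t \<in> A}) / T)
      \<longlongrightarrow> surface_area n b A / real n) at_top"
    using eq by (simp add: equidistributed_def)
  have never: "{t \<in> {0..T}. L t \<in> A} = {}" for T
    using avoid by (auto simp: A_def)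
  then have "((\<lambda>T::real. 0) \<longlongrightarrow> surface_area n b A / real n) at_top"
    using lim unfolding never by simp
  then have "surface_area n b A / real n = 0"
    by (rule tendsto_unique[OF trivial_limit_at_top_linorder _ tendsto_const])
  then have "surface_area n b A = 0" using n by simp
  moreover have "surface_area n b A = (\<Sum>l'\<in>{1..n}. if l' = l then measure lebesgue (ball z r) else 0)"
    unfolding surface_area_def using part by (intro sum.cong) auto
  then have "surface_area n b A = measure lebesgue (ball z r)"
    using l by simp
  moreover have "measure lebesgue (ball z r) > 0"
    using content_ball_pos[OF r, of z] by simp
  ultimately show False by simp
qed

text \<open>Modulo a common divisor \<open>e\<close> the function \<open>level\<close> is doubly periodic with period \<open>1\<close>. Around an offset
\<open>q\<close> off the jump lines it is equal to some constant \<open>c\<close>, so a curve that develops from the plane meets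
this neighbourhood only in squares with \<open>l - 1\<close> congruent to \<open>k + c\<close> modulo \<open>e\<close>.\<close>

lemma not_equidistributed_if_common_divisor:
  assumes n: "n \<ge> 2" and b: "0 < frac (real m * \<alpha>)"
    and e: "e > 1" "int e dvd int n" "int e dvd int m" "int e dvd \<lfloor>real m * \<alpha>\<rfloor>"
    and L: "\<And>t. t \<ge> 0 \<Longrightarrow> L t = develop n \<alpha> m k (p t)"
  shows "\<not> equidistributed n (frac (real m * \<alpha>)) L"
proof -
  let ?b = "frac (real m * \<alpha>)"
  let ?O = "{0<..<1::real} \<times> {0<..<1::real}"
  have O: "open ?O" by (intro open_Times) auto
  moreover have "?O \<noteq> {}" by auto
  ultimately obtain q where q: "q \<in> ?O" "q \<notin> jump_lines \<alpha>"
    using open_not_negligible negligible_jump_lines negligible_subset by (metis subsetI)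
  define c where "c = level \<alpha> m q"
  have "\<forall>\<^sub>F q' in nhds q. level \<alpha> m q' = c \<and> q' \<in> ?O"
    using level_locally_constant[OF q(2), of m] eventually_nhds_in_open[OF O q(1)]
    by eventually_elim (simp add: c_def)
  then obtain r where r: "r > 0" "\<And>q'. q' \<in> ball q r \<Longrightarrow> level \<alpha> m q' = c \<and> q' \<in> ?O"
    by (auto simp: eventually_nhds_metric dist_commute)
  obtain l where l: "l \<in> {1..n}" "\<not> int e dvd (k + c - (int l - 1))"
  \<comment> \<open>The indices \<open>1\<close> and \<open>2\<close> are not congruent modulo \<open>e\<close>, so one of these squares is avoided.\<close>
  proof (cases "int e dvd k + c")
    case True
    then have "\<not> int e dvd (k + c - (int 2 - 1))"
      using e(1) dvd_diff[of "int e" "k + c" "k + c - 1"] by auto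
    then show thesis using that[of 2] n by auto
  next
    case False
    then show thesis using that[of 1] n by auto
  qed
  define z where "z = (real l - 1, 0) + q"
  have ball_z: "w - (real l - 1, 0) \<in> ball q r" if "w \<in> ball z r" for w
    using that by (simp add: z_def dist_norm algebra_simps)
  show ?thesis
  proof (rule not_equidistributed_if_avoids_ball[OF b frac_lt_1 _ l(1) r(1)])
    show "n > 0" using n by simp
    show "ball z r \<subseteq> {real l - 1<..<real l} \<times> {0<..<1}"
      using ball_z r(2) by fastforce
    fix t :: real assume t: "t \<ge> 0"
    show "L t \<notin> surface_point n ?b l ` ball z r"
    proof
      assume "L t \<in> surface_point n ?b l ` ball z r"
      then obtain w where w: "w \<in> ball z r" "develop n \<alpha> m k (p t) = surface_point n ?b l w"
        using L[OF t] by auto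
      let ?w = "w - (real l - 1, 0)"
      have lw: "level \<alpha> m ?w = c" "?w \<in> ?O" using r(2)[OF ball_z[OF w(1)]] by auto
      then have red: "w \<in> reduced_square l" by (cases w) (auto simp: reduced_square_def)
      note inject = surface_point_inject[OF position_reduced red b frac_lt_1 w(2)[unfolded develop_def]]
      have sh: "sheet n \<alpha> m k (p t) = l" and pos: "position l (p t) = w"
        using inject(1) inject(2)[unfolded inject(1)] by auto
      have "p t = ?w + (of_int \<lfloor>fst (p t)\<rfloor>, of_int \<lfloor>snd (p t)\<rfloor>)"
        unfolding pos[symmetric] by (cases "p t") (simp add: position_def frac_def)
      then have lev: "level \<alpha> m (p t) = c + int m * \<lfloor>snd (p t)\<rfloor> - \<lfloor>real m * \<alpha>\<rfloor> * \<lfloor>fst (p t)\<rfloor>"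
        using level_shift[of \<alpha> m ?w] lw(1) by metis
      have "int l - 1 = (k + level \<alpha> m (p t)) mod int n"
        using sh n by (auto simp: sheet_def)
      then have "int n dvd (k + level \<alpha> m (p t)) - (int l - 1)"
        by (metis dvd_minus_mod)
      then have "int e dvd (k + level \<alpha> m (p t)) - (int l - 1)"
        using e(2) dvd_trans by blast
      moreover have "int e dvd int m * \<lfloor>snd (p t)\<rfloor> - \<lfloor>real m * \<alpha>\<rfloor> * \<lfloor>fst (p t)\<rfloor>"
        using e(3,4) by (intro dvd_diff dvd_mult2)
      ultimately have "int e dvd (k + level \<alpha> m (p t)) - (int l - 1) - (int m * \<lfloor>snd (p t)\<rfloor> - \<lfloor>real m * \<alpha>\<rfloor> * \<lfloor>fst (p t)\<rfloor>)"
        by (rule dvd_diff)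
      then show False using l(2) unfolding lev by (simp add: algebra_simps)
    qed
  qed
qed

text \<open>The visits of the geodesic to \<open>A\<close> are the visits of the line to the preimage of \<open>A\<close>, which has area
\<open>n\<close> times that of \<open>A\<close> in a fundamental square of area \<open>n\<^sup>2\<close>.\<close>

lemma equidistributed_if_coprime:
  assumes n: "n > 0" and \<alpha>: "\<alpha> \<notin> \<rat>"
    and cop: "gcd (int n) (gcd (int m) \<lfloor>real m * \<alpha>\<rfloor>) = 1"
    and L: "\<And>t. t \<ge> 0 \<Longrightarrow> L t = develop n \<alpha> m k (p + t *\<^sub>R unit_direction \<alpha>)"
  shows "equidistributed n (frac (real m * \<alpha>)) L"
  unfolding equidistributed_def
proof (intro allI impI)
  fix A assume A: "jordan_measurable_on_surface n (frac (real m * \<alpha>)) A"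
  let ?B = "develop n \<alpha> m k -` A"
  have dir: "unit_direction \<alpha> = (1 / norm (1 :: real, \<alpha>), \<alpha> / norm (1 :: real, \<alpha>))"
    by (simp add: unit_direction_def divide_inverse mult.commute)
  have pos: "norm (1 :: real, \<alpha>) > 0" by (simp add: zero_prod_def)
  have "{t \<in> {0..T}. L t \<in> A} = {t \<in> {0..T}. p + t *\<^sub>R unit_direction \<alpha> \<in> ?B}" for T
    using L by auto
  moreover have "((\<lambda>T. enn2real (outer_measure_of lebesgue {t \<in> {0..T}. p + t *\<^sub>R unit_direction \<alpha> \<in> ?B}) / T)
      \<longlongrightarrow> measure lebesgue (?B \<inter> {0..<real n} \<times> {0..<real n}) / (real n)\<^sup>2) at_top"
    using n \<alpha> pos
    by (intro irrational_line_equidistributed doubly_periodic_develop negligible_frontier_develop A) (auto simp: dir)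
  ultimately show "((\<lambda>T. enn2real (outer_measure_of lebesgue {t \<in> {0..T}. L t \<in> A}) / T)
      \<longlongrightarrow> surface_area n (frac (real m * \<alpha>)) A / real n) at_top"
    using n by (simp add: measure_develop_vimage[OF n A cop] power2_eq_square)
qed

theorem theorem2p1:
  fixes n m d :: nat and \<alpha> b :: real and L :: "real \<Rightarrow> tagged_point set"
  assumes "n \<ge> 2" and "m \<ge> 1"
    and "0 < \<alpha>" and "\<alpha> < 1" and "\<alpha> \<notin> \<rat>"
    and "b = frac (real m * \<alpha>)"
    and "d = gcd n (gcd m (Upsilon m \<alpha>))"
    and "half_infinite_geodesic n b \<alpha> L"
  shows "equidistributed n b L \<longleftrightarrow> \<not> d > 1"
proof -
  have "real m * \<alpha> \<notin> \<int>"
  proof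
    assume "real m * \<alpha> \<in> \<int>"
    then have "real m * \<alpha> / real m \<in> \<rat>" using Ints_subset_Rats by (intro Rats_divide) auto
    then show False using assms(2,5) by simp
  qed
  then have b: "0 < frac (real m * \<alpha>)" by simp
  obtain k p where L: "\<And>t. t \<ge> 0 \<Longrightarrow> L t = develop n \<alpha> m k (p + t *\<^sub>R unit_direction \<alpha>)"
    using geodesic_is_developed_line[of n \<alpha> m L] assms b by auto
  have d: "int d = gcd (int n) (gcd (int m) \<lfloor>real m * \<alpha>\<rfloor>)"
    using assms(7) Upsilon_eq_floor[OF assms(3,4), of m] by (metis gcd_int_int_eq)
  show ?thesis
  proof (cases "d > 1")
    case True
    have "\<not> equidistributed n (frac (real m * \<alpha>)) L"
      by (rule not_equidistributed_if_common_divisor[OF assms(1) b True _ _ _ L])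
        (auto simp: d intro: dvd_trans[OF gcd_dvd2])
    then show ?thesis using True assms(6) by simp
  next
    case False
    moreover have "d > 0" using assms(1,7) by simp
    ultimately have "int d = 1" by simp
    then have "equidistributed n (frac (real m * \<alpha>)) L"
      using assms(1,5) d L by (intro equidistributed_if_coprime) auto
    then show ?thesis using False assms(6) by simp
  qed
qed

end
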